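(* For every fixed integer $m\ge1$, $$c_{m,n}=\pi-\Theta_m\left(n^{-1/m}\right)\qquad(n\to\infty).$$ That is, there are constants $0<C_m^-\le C_m^+<\infty$ depending only on $m$ such that $C_m^-n^{-1/m}\le\pi-c_{m,n}\le C_m^+n^{-1/m}$ for all sufficiently large $n$.
   Context: For $m\ge1$, $\mathbb S^m\subset\mathbb R^{m+1}$ is the unit round sphere with geodesic metric $\arccos\langle x,x'\rangle$; $\mathbb S^0$ is two points at distance $\pi$. The group $C_2$ of order two acts antipodally on each sphere; a map between $C_2$-spaces is odd if it is $C_2$-equivariant. The coindex of a $C_2$-space $X$ is $\mathrm{coind}(X):=\sup\{k\ge0:\text{there is a continuous odd map }\mathbb S^k\to X\}$. $\mathrm{VR}(X;r)$ is the geometric realization of the simplicial complex with vertex set $X$ whose simplices are the nonempty finite subsets of diameter at most $r$; $\mathrm{VR}(\mathbb S^m;r)$ carries the $C_2$-action induced by the antipodal map. For integers $0\le m\le n$, $c_{m,n}:=\inf\{r\ge0:\mathrm{coind}(\mathrm{VR}(\mathbb S^m;r))\ge n\}$. *)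

theory Defs
  imports "HOL-Homology.Homology" "HOL-Library.Extended_Nat"
begin

definition antipode :: "(nat \<Rightarrow> real) \<Rightarrow> nat \<Rightarrow> real"
  where "antipode x = (\<lambda>i. - x i)"

definition geodesic_dist :: "nat \<Rightarrow> (nat \<Rightarrow> real) \<Rightarrow> (nat \<Rightarrow> real) \<Rightarrow> real"
  where "geodesic_dist m x y = arccos (\<Sum>i\<le>m. x i * y i)"

text \<open>A space with an action of the group of order two is given by a topology and the
  map by which the non-trivial element acts.\<close>

definition odd_map ::
  "'a topology \<Rightarrow> ('a \<Rightarrow> 'a) \<Rightarrow> 'b topology \<Rightarrow> ('b \<Rightarrow> 'b) \<Rightarrow> ('a \<Rightarrow> 'b) \<Rightarrow> bool"
  where "odd_map X a Y b f \<longleftrightarrow>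
    continuous_map X Y f \<and> (\<forall>x\<in>topspace X. f (a x) = b (f x))"

text \<open>The supremum lives in the extended naturals, since the coindex may be infinite. The
  set is empty only if the space is, and then the supremum below is 0; the Vietoris--Rips
  complexes of spheres considered here (scale at least 0) are never empty.\<close>

definition coind :: "'a topology \<Rightarrow> ('a \<Rightarrow> 'a) \<Rightarrow> enat"
  where "coind X a = (SUP k \<in> {k. \<exists>f. odd_map (nsphere k) antipode X a f}. enat k)"

text \<open>Points of the realization are barycentric coordinate functions on all of the vertex
  type, vanishing outside the simplex.\<close>

definition closed_simplex :: "'v set \<Rightarrow> ('v \<Rightarrow> real) set"
  where "closed_simplex \<sigma> =
    {t. (\<forall>v. 0 \<le> t v) \<and> (\<forall>v. v \<notin> \<sigma> \<longrightarrow> t v = 0) \<and> (\<Sum>v\<in>\<sigma>. t v) = 1}"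

text \<open>The topology is the weak one (coherent with the closed simplices). Each closed simplex
  carries the subspace topology from the product topology on functions; for finite simplices
  this is the Euclidean topology.\<close>

definition geometric_realization :: "'v set set \<Rightarrow> ('v \<Rightarrow> real) topology"
  where "geometric_realization K = topology (\<lambda>U.
    U \<subseteq> (\<Union>\<sigma>\<in>K. closed_simplex \<sigma>) \<and>
    (\<forall>\<sigma>\<in>K. openin (top_of_set (closed_simplex \<sigma>)) (closed_simplex \<sigma> \<inter> U)))"

lemma openin_geometric_realization:
  "openin (geometric_realization K) U \<longleftrightarrow>
    U \<subseteq> (\<Union>\<sigma>\<in>K. closed_simplex \<sigma>) \<and>
    (\<forall>\<sigma>\<in>K. openin (top_of_set (closed_simplex \<sigma>)) (closed_simplex \<sigma> \<inter> U))"
proof -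
  let ?P = "\<lambda>U. U \<subseteq> (\<Union>\<sigma>\<in>K. closed_simplex \<sigma>) \<and>
    (\<forall>\<sigma>\<in>K. openin (top_of_set (closed_simplex \<sigma>)) (closed_simplex \<sigma> \<inter> U))"
  have Int: "?P (S \<inter> T)" if S: "?P S" and T: "?P T" for S T
  proof (intro conjI ballI)
    show "S \<inter> T \<subseteq> (\<Union>\<sigma>\<in>K. closed_simplex \<sigma>)"
      using S by (rule le_infI1[OF conjunct1])
    fix \<sigma> assume "\<sigma> \<in> K"
    from openin_Int[OF bspec[OF conjunct2[OF S] this] bspec[OF conjunct2[OF T] this]]
    show "openin (top_of_set (closed_simplex \<sigma>)) (closed_simplex \<sigma> \<inter> (S \<inter> T))"
      by (simp only: Int_ac Int_absorb)
  qed
  have Un: "?P (\<Union>\<U>)" if \<U>: "\<forall>S\<in>\<U>. ?P S" for \<U>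
  proof (intro conjI ballI)
    show "\<Union>\<U> \<subseteq> (\<Union>\<sigma>\<in>K. closed_simplex \<sigma>)"
      by (rule Union_least) (rule conjunct1[OF bspec[OF \<U>]])
    fix \<sigma> assume \<sigma>: "\<sigma> \<in> K"
    have "openin (top_of_set (closed_simplex \<sigma>)) (\<Union>S\<in>\<U>. closed_simplex \<sigma> \<inter> S)"
    proof (rule openin_Union)
      fix A assume "A \<in> (\<lambda>S. closed_simplex \<sigma> \<inter> S) ` \<U>"
      then obtain S where "S \<in> \<U>" "A = closed_simplex \<sigma> \<inter> S" by (rule imageE)
      then show "openin (top_of_set (closed_simplex \<sigma>)) A"
        using bspec[OF conjunct2[OF bspec[OF \<U> \<open>S \<in> \<U>\<close>]] \<sigma>] by (simp only:)
    qed
    then show "openin (top_of_set (closed_simplex \<sigma>)) (closed_simplex \<sigma> \<inter> \<Union>\<U>)"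
      by (simp only: Int_Union)
  qed
  have "istopology ?P"
    unfolding istopology_def by (rule conjI; intro allI impI; (rule Int Un; assumption))
  then show ?thesis
    unfolding geometric_realization_def by (simp only: topology_inverse')
qed

lemma topspace_geometric_realization:
  "topspace (geometric_realization K) = (\<Union>\<sigma>\<in>K. closed_simplex \<sigma>)"
proof -
  have "closed_simplex \<sigma> \<inter> (\<Union>\<tau>\<in>K. closed_simplex \<tau>) = closed_simplex \<sigma>"
    if "\<sigma> \<in> K" for \<sigma> :: "'a set"
    using that by blast
  then have "openin (geometric_realization K) (\<Union>\<sigma>\<in>K. closed_simplex \<sigma>)"
    unfolding openin_geometric_realization
    by (metis openin_subtopology_self subset_refl)
  moreover have "topspace (geometric_realization K) \<subseteq> (\<Union>\<sigma>\<in>K. closed_simplex \<sigma>)"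
    using openin_topspace[of "geometric_realization K"]
    unfolding openin_geometric_realization[of K "topspace (geometric_realization K)"]
    by (rule conjunct1)
  ultimately show ?thesis
    by (intro subset_antisym openin_subset)
qed

definition diam_wrt :: "('a \<Rightarrow> 'a \<Rightarrow> real) \<Rightarrow> 'a set \<Rightarrow> real"
  where "diam_wrt d \<sigma> = (SUP (x, y) \<in> \<sigma> \<times> \<sigma>. d x y)"

definition VR_complex :: "'a set \<Rightarrow> ('a \<Rightarrow> 'a \<Rightarrow> real) \<Rightarrow> real \<Rightarrow> 'a set set"
  where "VR_complex X d r = {\<sigma>. \<sigma> \<subseteq> X \<and> finite \<sigma> \<and> \<sigma> \<noteq> {} \<and> diam_wrt d \<sigma> \<le> r}"

definition VR_sphere :: "nat \<Rightarrow> real \<Rightarrow> ((nat \<Rightarrow> real) \<Rightarrow> real) topology"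
  where "VR_sphere m r =
    geometric_realization (VR_complex (topspace (nsphere m)) (geodesic_dist m) r)"

text \<open>The simplicial map induced by a vertex map pushes barycentric coordinates forward,
  that is, it composes them with the inverse vertex map; the antipode is its own inverse.\<close>

definition VR_antipode :: "((nat \<Rightarrow> real) \<Rightarrow> real) \<Rightarrow> (nat \<Rightarrow> real) \<Rightarrow> real"
  where "VR_antipode t = (\<lambda>x. t (antipode x))"

definition c_VR :: "nat \<Rightarrow> nat \<Rightarrow> real"
  where "c_VR m n = Inf {r. 0 \<le> r \<and> enat n \<le> coind (VR_sphere m r) VR_antipode}"

end

theory Submission
  imports Defs
begin

text \<open>
  Both bounds compare the Vietoris--Rips complex of \<open>S\<^sup>m\<close> at scale \<open>\<pi> - \<delta>\<close> with spheres by odd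
  maps; the dimensions of these spheres are a packing number and a covering number of \<open>S\<^sup>m\<close> at
  scale \<open>\<delta>\<close>, and both are of order \<open>\<delta>\<^bsup>-m\<^esup>\<close>.

  Packing. Take points \<open>p\<^sub>0, \<dots>, p\<^sub>n\<close> such that the \<open>2n + 2\<close> points \<open>\<plusminus>p\<^sub>i\<close> are pairwise at
  distance at least \<open>\<delta>\<close>. A choice of signs \<open>\<epsilon>\<^sub>i\<close> gives a set \<open>{\<epsilon>\<^sub>i p\<^sub>i}\<close> of diameter at most
  \<open>\<pi> - \<delta>\<close>, because the distance from \<open>x\<close> to \<open>y\<close> is \<open>\<pi>\<close> minus the distance from \<open>x\<close> to \<open>-y\<close>. So
  the boundary of the cross-polytope on the \<open>\<plusminus>p\<^sub>i\<close>, which is an antipodal \<open>S\<^sup>n\<close>, sits in the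
  complex, and \<open>c\<^bsub>m,n\<^esub> \<le> \<pi> - \<delta>\<close> (lemma \<open>c_VR_le\<close>).

  Covering. Let \<open>C\<^sub>1, \<dots>, C\<^sub>N\<close> be sets of diameter less than \<open>\<delta>\<close> that cover \<open>S\<^sup>m\<close> together with
  their antipodes. Send a point of the complex with barycentric coordinates \<open>t\<close> to the vector
  whose \<open>i\<close>-th entry is the weight that \<open>t\<close> puts on \<open>C\<^sub>i\<close> minus the weight that it puts on
  \<open>-C\<^sub>i\<close>. At scale \<open>\<pi> - \<delta>\<close> no simplex meets both \<open>C\<^sub>i\<close> and \<open>-C\<^sub>i\<close>, so nothing cancels and this
  odd map to \<open>\<real>\<^sup>N\<close> has no zero. By the Borsuk--Ulam theorem an odd map from \<open>S\<^sup>n\<close> to the complex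
  forces \<open>n < N\<close>, which bounds \<open>c\<^bsub>m,n\<^esub>\<close> from below (lemma \<open>c_VR_ge\<close>).

  The Borsuk--Ulam theorem itself is proved by Fan's parity argument on singular chains. The
  vanishing of the reduced homology of \<open>S\<^sup>n\<close> below degree \<open>n\<close> gives chains \<open>c\<^sub>0, \<dots>, c\<^sub>n\<close> that
  behave like hemispheres: \<open>c\<^sub>0\<close> is a point and the boundary of \<open>c\<^bsub>k+1\<^esub>\<close> is \<open>c\<^sub>k\<close> plus or minus
  its antipode. Barycentric subdivision makes them as fine as desired. If an odd map \<open>f\<close> to
  \<open>\<real>\<^sup>n\<close> had no zero, label a point \<open>x\<close> by \<open>\<plusminus>(i + 1)\<close>, where \<open>i\<close> is the first index at which
  \<open>\<bar>f x i\<bar>\<close> is maximal and the sign is that of \<open>f x i\<close>. On fine simplices opposite labels do not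
  meet, and then the number of simplices of \<open>c\<^sub>k\<close>, counted with coefficients, whose labels have
  distinct absolute values and alternating signs is odd for every \<open>k\<close>. For \<open>k = n\<close> this needs
  \<open>n + 1\<close> distinct absolute values, but only \<open>n\<close> are available.
\<close>

section \<open>Alternating sets of labels\<close>

text \<open>
  For labels with distinct absolute values, listed in the order of these, the signs alternate,
  starting with a positive one if \<open>b\<close> holds and with a negative one otherwise. The rank of an
  element is counted directly, which avoids sorted lists.
\<close>

definition alternates :: "bool \<Rightarrow> int set \<Rightarrow> bool"
  where "alternates b A \<longleftrightarrow> (\<forall>x\<in>A. 0 < x \<longleftrightarrow> (b \<longleftrightarrow> even (card {y\<in>A. \<bar>y\<bar> < \<bar>x\<bar>})))"

lemma alternates_insert_max:
  assumes max: "\<And>y. y \<in> B \<Longrightarrow> \<bar>y\<bar> < \<bar>z\<bar>"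
  shows "alternates b (insert z B) \<longleftrightarrow> alternates b B \<and> (0 < z \<longleftrightarrow> (b \<longleftrightarrow> even (card B)))"
proof -
  have "{y \<in> insert z B. \<bar>y\<bar> < \<bar>z\<bar>} = B" using max by auto
  moreover have "{y \<in> insert z B. \<bar>y\<bar> < \<bar>x\<bar>} = {y \<in> B. \<bar>y\<bar> < \<bar>x\<bar>}" if "x \<in> B" for x
    using max[OF that] by auto
  ultimately show ?thesis
    by (auto simp: alternates_def)
qed

lemma alternates_uminus:
  assumes "0 \<notin> A"
  shows "alternates b (uminus ` A) \<longleftrightarrow> alternates (\<not> b) A"
proof -
  have "{y \<in> uminus ` A. \<bar>y\<bar> < \<bar>- x\<bar>} = uminus ` {y \<in> A. \<bar>y\<bar> < \<bar>x\<bar>}" for x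
    by auto
  then have "card {y \<in> uminus ` A. \<bar>y\<bar> < \<bar>- x\<bar>} = card {y \<in> A. \<bar>y\<bar> < \<bar>x\<bar>}" for x
    by (simp add: card_image)
  moreover have "0 < - x \<longleftrightarrow> \<not> 0 < x" if "x \<in> A" for x
    using that assms by (cases "x = 0") auto
  ultimately show ?thesis
    by (auto simp: alternates_def)
qed

text \<open>
  The heart of Fan's argument for a set of distinct labels. It goes by induction, adding an
  element \<open>z\<close> of largest absolute value to \<open>B\<close>. If \<open>z\<close> has the sign that a positive alternation
  of \<open>B\<close> would continue with, then after deleting any other element it has the wrong sign, so
  only the deletion of \<open>z\<close> can count; otherwise each deletion from \<open>B\<close> counts exactly if it did
  before \<open>z\<close> was added, and the induction hypothesis applies.
\<close>

lemma card_alternating_deletions: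
  assumes "finite A" "inj_on abs A"
  shows "even (card {x \<in> A. alternates True (A - {x})}
    + of_bool (alternates True A) + of_bool (alternates False A))"
  using assms
proof (induction A rule: finite_ranking_induct[where f = "abs :: int \<Rightarrow> int"])
  case empty
  show ?case by (simp add: alternates_def)
next
  case (insert z B)
  show ?case
  proof (cases "z \<in> B")
    case True
    then have eq: "insert z B = B" by (rule insert_absorb)
    show ?thesis
      unfolding eq by (rule insert.IH) (rule insert.prems[unfolded eq])
  next
    case False
    have lt: "\<bar>y\<bar> < \<bar>z\<bar>" if "y \<in> B" for y
      using insert.hyps(2)[OF that] inj_onD[OF insert.prems, of y z] False that
      by (cases "\<bar>y\<bar> = \<bar>z\<bar>") auto
    define t where "t \<longleftrightarrow> (0 < z \<longleftrightarrow> even (card B))"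
    have del: "alternates True (insert z B - {x}) \<longleftrightarrow> alternates True (B - {x}) \<and> \<not> t"
      if "x \<in> B" for x
    proof -
      have "insert z B - {x} = insert z (B - {x})"
        using that False by auto
      moreover have "card B = Suc (card (B - {x}))"
        using that insert.hyps(1) by (metis card_Suc_Diff1)
      ultimately show ?thesis
        using alternates_insert_max[of "B - {x}" z True] lt by (simp add: t_def)
    qed
    define Q where "Q = {x \<in> B. alternates True (B - {x})}"
    have Q: "finite Q" "z \<notin> Q"
      using insert.hyps(1) False by (simp_all add: Q_def)
    have "{x \<in> insert z B. alternates True (insert z B - {x})}
        = (if alternates True B then {z} else {}) \<union> (if t then {} else Q)"
      using del False by (auto simp: Q_def)
    then have "card {x \<in> insert z B. alternates True (insert z B - {x})}
        = of_bool (alternates True B) + (if t then 0 else card Q)"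
      using Q by simp
    moreover have "alternates True (insert z B) \<longleftrightarrow> alternates True B \<and> t"
      "alternates False (insert z B) \<longleftrightarrow> alternates False B \<and> \<not> t"
      using alternates_insert_max[OF lt] by (auto simp: t_def)
    moreover have "inj_on abs B"
      using insert.prems by (simp add: inj_on_def)
    ultimately show ?thesis
      using insert.IH unfolding Q_def[symmetric] by (cases t; cases "alternates True B"; cases "alternates False B") simp_all
  qed
qed

text \<open>
  If a label is repeated, the only facets that can avoid repetition are the two that omit one of
  its two occurrences; these carry the same labels, so they count both or not at all. Without
  repetition this is \<open>card_alternating_deletions\<close>.
\<close>

lemma card_alternating_faces:
  fixes l :: "nat \<Rightarrow> int"
  assumes opp: "\<And>i j. i \<in> S \<Longrightarrow> j \<in> S \<Longrightarrow> l i \<noteq> - l j" and fin: "finite S"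
  shows "even (card {i \<in> S. inj_on l (S - {i}) \<and> alternates True (l ` (S - {i}))}
    + of_bool (inj_on l S \<and> alternates True (l ` S))
    + of_bool (inj_on l S \<and> alternates False (l ` S)))"
proof (cases "inj_on l S")
  case True
  let ?D = "{x \<in> l ` S. alternates True (l ` S - {x})}"
  have "l ` (S - {i}) = l ` S - {l i}" if "i \<in> S" for i
    using True that by (auto simp: inj_on_def)
  moreover have "inj_on l (S - {i})" for i
    using True by (rule inj_on_subset) blast
  ultimately have "{i \<in> S. inj_on l (S - {i}) \<and> alternates True (l ` (S - {i}))}
      = {i \<in> S. alternates True (l ` S - {l i})}"
    by (simp cong: conj_cong)
  then have "l ` {i \<in> S. inj_on l (S - {i}) \<and> alternates True (l ` (S - {i}))} = ?D"
    by (simp only:) blast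
  then have "card {i \<in> S. inj_on l (S - {i}) \<and> alternates True (l ` (S - {i}))} = card ?D"
    using True by (metis (no_types, lifting) card_image inj_on_subset mem_Collect_eq subsetI)
  moreover have "inj_on abs (l ` S)"
    using opp by (force simp: inj_on_def abs_eq_iff)
  ultimately show ?thesis
    using card_alternating_deletions[of "l ` S"] True fin by simp
next
  case False
  let ?F = "{i \<in> S. inj_on l (S - {i}) \<and> alternates True (l ` (S - {i}))}"
  have "even (card ?F)"
  proof (cases "?F = {}")
    case True
    then show ?thesis by (simp only: card.empty) simp
  next
    case nonempty: False
    then obtain i where i: "i \<in> S" "inj_on l (S - {i})" "alternates True (l ` (S - {i}))"
      by auto
    obtain p q where pq: "p \<in> S" "q \<in> S" "p \<noteq> q" "l p = l q"
      using False by (auto simp: inj_on_def)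
    have "p = i \<or> q = i"
      using inj_onD[OF i(2) pq(4)] pq by blast
    then obtain j where j: "j \<in> S" "j \<noteq> i" "l j = l i"
      using pq by (elim disjE) (simp_all add: that)
    have im: "l ` (S - {i}) = l ` S" "l ` (S - {j}) = l ` S"
    proof -
      have "l ` S = insert (l i) (l ` (S - {i}))" "l ` S = insert (l j) (l ` (S - {j}))"
        using i(1) j(1) by blast+
      moreover have "l i \<in> l ` (S - {i})"
        using j by (intro image_eqI[of _ _ j]) auto
      moreover have "l j \<in> l ` (S - {j})"
        using i(1) j by (intro image_eqI[of _ _ i]) auto
      ultimately show "l ` (S - {i}) = l ` S" "l ` (S - {j}) = l ` S"
        by (simp_all only: insert_absorb)
    qed
    have "inj_on l (S - {j})"
    proof (rule inj_onI)
      fix x y assume xy: "x \<in> S - {j}" "y \<in> S - {j}" "l x = l y"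
      show "x = y"
      proof (cases "x = i \<or> y = i")
        case True
        then show ?thesis
          using inj_onD[OF i(2), of j x] inj_onD[OF i(2), of j y] xy j by auto
      next
        case False
        then show ?thesis
          using inj_onD[OF i(2), of x y] xy by auto
      qed
    qed
    with i(3) j(1) have "j \<in> ?F"
      by (simp only: im mem_Collect_eq simp_thms)
    moreover have "i \<in> ?F"
      using i by (simp only: mem_Collect_eq simp_thms)
    moreover have "\<not> inj_on l (S - {h})" if "h \<noteq> i" "h \<noteq> j" for h
      using inj_onD[of l "S - {h}" i j] i(1) j that by auto
    ultimately have "?F = {i, j}"
      by blast
    with j show ?thesis by simp
  qed
  with False show ?thesis by simp
qed

section \<open>Counting simplices in singular chains\<close>

text \<open>
  The sum of the coefficients over the simplices with property \<open>P\<close>. Writing it through the free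
  abelian group on one generator makes additivity an instance of that of \<open>frag_extend\<close>.
\<close>

definition weight :: "('a \<Rightarrow> bool) \<Rightarrow> ('a \<Rightarrow>\<^sub>0 int) \<Rightarrow> int"
  where "weight P c =
    Poly_Mapping.lookup (frag_extend (\<lambda>s. if P s then frag_of () else 0) c) ()"

lemma weight_0 [simp]: "weight P 0 = 0"
  by (simp add: weight_def)

lemma weight_of [simp]: "weight P (frag_of s) = of_bool (P s)"
  by (simp add: weight_def)

lemma weight_diff: "weight P (c - d) = weight P c - weight P d"
  by (simp add: weight_def frag_extend_diff lookup_minus)

lemma weight_cmul: "weight P (frag_cmul k c) = k * weight P c"
  by (simp add: weight_def frag_extend_cmul)

lemma weight_sum: "finite I \<Longrightarrow> weight P (\<Sum>i\<in>I. c i) = (\<Sum>i\<in>I. weight P (c i))"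
  by (simp add: weight_def frag_extend_sum lookup_sum)

lemma weight_eq_0:
  assumes "\<And>s. s \<in> Poly_Mapping.keys c \<Longrightarrow> \<not> P s"
  shows "weight P c = 0"
  unfolding weight_def using assms by (subst frag_extend_eq_0) auto

lemma weight_chain_map: "weight P (chain_map k g c) = weight (\<lambda>s. P (simplex_map k g s)) c"
  unfolding weight_def chain_map_def frag_extend_compose by (simp add: o_def)

lemma weight_cong:
  assumes "\<And>s. s \<in> Poly_Mapping.keys c \<Longrightarrow> P s \<longleftrightarrow> Q s"
  shows "weight P c = weight Q c"
  unfolding weight_def using assms by (subst frag_extend_eq) auto

definition vertex :: "nat \<Rightarrow> nat \<Rightarrow> real"
  where "vertex i = (\<lambda>j. if j = i then 1 else 0)"

lemma vertex_in_standard_simplex [simp]: "vertex i \<in> standard_simplex k \<longleftrightarrow> i \<le> k"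
  by (simp add: vertex_def)

lemma simplical_face_vertex: "simplical_face i (vertex j) = vertex (if j < i then j else Suc j)"
  by (auto simp: simplical_face_def vertex_def fun_eq_iff)

definition alternating_simplex :: "('a \<Rightarrow> int) \<Rightarrow> bool \<Rightarrow> nat \<Rightarrow> ((nat \<Rightarrow> real) \<Rightarrow> 'a) \<Rightarrow> bool"
  where "alternating_simplex l b k s \<longleftrightarrow>
    inj_on (\<lambda>i. l (s (vertex i))) {..k} \<and> alternates b ((\<lambda>i. l (s (vertex i))) ` {..k})"

text \<open>
  Passing to the \<open>i\<close>-th face renumbers the vertices, which affects neither the set of labels nor
  whether labels repeat.
\<close>

lemma alternating_singular_face:
  assumes "i \<le> Suc k"
  shows "alternating_simplex l b k (singular_face (Suc k) i s) \<longleftrightarrow>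
    inj_on (\<lambda>i. l (s (vertex i))) ({..Suc k} - {i}) \<and>
    alternates b ((\<lambda>i. l (s (vertex i))) ` ({..Suc k} - {i}))"
proof -
  define skip where "skip j = (if j < i then j else Suc j)" for j
  have inj: "inj_on skip {..k}"
    by (auto simp: inj_on_def skip_def split: if_splits)
  have "j \<in> skip ` {..k}" if "j \<le> Suc k" "j \<noteq> i" for j
    using that assms by (intro image_eqI[of _ _ "if j < i then j else j - 1"]) (auto simp: skip_def)
  then have im: "skip ` {..k} = {..Suc k} - {i}"
    using assms by (auto simp: skip_def)
  have "l (singular_face (Suc k) i s (vertex j)) = l (s (vertex (skip j)))" if "j \<le> k" for j
    using that by (simp add: singular_face_def simplical_face_vertex skip_def)
  then have "alternating_simplex l b k (singular_face (Suc k) i s) \<longleftrightarrow>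
    inj_on ((\<lambda>i. l (s (vertex i))) \<circ> skip) {..k} \<and>
    alternates b (((\<lambda>i. l (s (vertex i))) \<circ> skip) ` {..k})"
    unfolding alternating_simplex_def
    by (intro arg_cong2[of _ _ _ _ "(\<and>)"] inj_on_cong arg_cong[of _ _ "alternates b"] image_cong) auto
  also have "\<dots> \<longleftrightarrow>
    inj_on (\<lambda>i. l (s (vertex i))) ({..Suc k} - {i}) \<and>
    alternates b ((\<lambda>i. l (s (vertex i))) ` ({..Suc k} - {i}))"
    unfolding comp_inj_on_iff[OF inj, symmetric] image_comp[symmetric] im ..
  finally show ?thesis .
qed

lemma alternating_simplex_map:
  assumes s: "singular_simplex k X s"
    and odd: "\<And>x. x \<in> topspace X \<Longrightarrow> l (a x) = - l x"
    and nz: "\<And>x. x \<in> topspace X \<Longrightarrow> l x \<noteq> 0"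
  shows "alternating_simplex l b k (simplex_map k a s) \<longleftrightarrow> alternating_simplex l (\<not> b) k s"
proof -
  let ?l = "\<lambda>i. l (s (vertex i))"
  have X: "s (vertex i) \<in> topspace X" if "i \<le> k" for i
    using s that by (auto simp: singular_simplex_def continuous_map_def Pi_iff)
  then have eq: "l (simplex_map k a s (vertex i)) = - ?l i" if "i \<in> {..k}" for i
    using that by (simp add: simplex_map_def odd)
  have "inj_on (\<lambda>i. l (simplex_map k a s (vertex i))) {..k} \<longleftrightarrow> inj_on ?l {..k}"
    using eq by (simp add: inj_on_def)
  moreover have "(\<lambda>i. l (simplex_map k a s (vertex i))) ` {..k} = uminus ` ?l ` {..k}"
    unfolding image_image by (rule image_cong) (use eq in auto)
  moreover have "0 \<notin> ?l ` {..k}"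
    using nz[OF X] by force
  ultimately show ?thesis
    using alternates_uminus[of "?l ` {..k}"] by (simp only: alternating_simplex_def not_not simp_thms)
qed

text \<open>
  Modulo 2 the signs in the boundary disappear, and on each simplex of \<open>c\<close> the claim is
  \<open>card_alternating_faces\<close>. In terms of cochains modulo 2 on simplices without opposite labels:
  the coboundary of ``alternating, first sign positive'' is ``alternating, either first sign''.
\<close>

lemma weight_alternating_boundary:
  assumes "\<And>s i j. s \<in> Poly_Mapping.keys c \<Longrightarrow> i \<le> Suc k \<Longrightarrow> j \<le> Suc k \<Longrightarrow>
    l (s (vertex i)) \<noteq> - l (s (vertex j))"
  shows "even (weight (alternating_simplex l True k) (chain_boundary (Suc k) c)
    + weight (alternating_simplex l True (Suc k)) c + weight (alternating_simplex l False (Suc k)) c)"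
proof -
  define S where "S = {s. \<forall>i\<le>Suc k. \<forall>j\<le>Suc k. l (s (vertex i)) \<noteq> - l (s (vertex j))}"
  have "Poly_Mapping.keys c \<subseteq> S"
    using assms by (auto simp: S_def)
  then show ?thesis
  proof (induction c rule: frag_induction)
    case zero
    show ?case by simp
  next
    case (diff c d)
    then show ?case
      by (simp add: chain_boundary_diff weight_diff) presburger
  next
    case (one s)
    let ?F = "{i \<in> {..Suc k}. alternating_simplex l True k (singular_face (Suc k) i s)}"
    have F: "?F = {i \<in> {..Suc k}. inj_on (\<lambda>i. l (s (vertex i))) ({..Suc k} - {i}) \<and>
      alternates True ((\<lambda>i. l (s (vertex i))) ` ({..Suc k} - {i}))}"
      by (simp add: alternating_singular_face cong: conj_cong)
    have "weight (alternating_simplex l True k) (chain_boundary (Suc k) (frag_of s))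
      = (\<Sum>i\<le>Suc k. (-1) ^ i * of_bool (alternating_simplex l True k (singular_face (Suc k) i s)))"
      by (simp add: chain_boundary_of weight_sum weight_cmul del: sum.atMost_Suc)
    also have "even (\<dots> - (\<Sum>i\<le>Suc k. of_bool (alternating_simplex l True k (singular_face (Suc k) i s))))"
      unfolding sum_subtractf[symmetric] by (rule dvd_sum) auto
    finally have "even (weight (alternating_simplex l True k) (chain_boundary (Suc k) (frag_of s)) - int (card ?F))"
      by (simp add: sum.If_cases of_bool_def Int_def del: sum.atMost_Suc)
    moreover have "even (card ?F + of_bool (alternating_simplex l True (Suc k) s)
      + of_bool (alternating_simplex l False (Suc k) s))"
      unfolding F unfolding alternating_simplex_def
      by (rule card_alternating_faces) (use one in \<open>auto simp: S_def\<close>)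
    then have "even (int (card ?F) + of_bool (alternating_simplex l True (Suc k) s)
      + of_bool (alternating_simplex l False (Suc k) s))"
      unfolding of_nat_of_bool[where 'a = int, symmetric] of_nat_add[symmetric] even_of_nat .
    ultimately show ?case
      by simp
  qed
qed

section \<open>Towers of hemispheres\<close>

text \<open>
  The model is the filtration of \<open>S\<^sup>n\<close> by equators: \<open>c k\<close> stands for a hemisphere of dimension
  \<open>k\<close>, whose boundary is the equator, made of the two hemispheres of dimension \<open>k - 1\<close>. The sign
  \<open>(-1) ^ k\<close> is the one that makes the right-hand side a cycle.
\<close>

definition hemisphere_tower :: "'a topology \<Rightarrow> ('a \<Rightarrow> 'a) \<Rightarrow> nat \<Rightarrow> (nat \<Rightarrow> 'a chain) \<Rightarrow> bool"
  where "hemisphere_tower X a n c \<longleftrightarrow>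
    (\<exists>s. c 0 = frag_of s) \<and> (\<forall>k\<le>n. singular_chain k X (c k)) \<and>
    (\<forall>k<n. chain_boundary (Suc k) (c (Suc k)) = c k - frag_cmul ((-1) ^ k) (chain_map k a (c k)))"

text \<open>
  In degree 0 the reduced homology group consists only of classes that vanish when the space is
  collapsed to a point, hence the extra hypothesis there.
\<close>

lemma cycle_is_boundary:
  assumes triv: "trivial_group (reduced_homology_group (int k) X)"
    and z: "singular_chain k X z" "chain_boundary k z = 0"
    and pt: "k = 0 \<Longrightarrow> chain_map k (\<lambda>x. ()) z = 0"
  shows "\<exists>d. singular_chain (Suc k) X d \<and> chain_boundary (Suc k) d = z"
proof -
  let ?pt = "discrete_topology {()}"
  let ?z = "homologous_rel_set k X {} z"
  have cyc: "singular_relcycle k X {} z"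
    using z by (simp add: singular_cycle)
  have "?z \<in> carrier (reduced_homology_group (int k) X)"
  proof (cases "k = 0")
    case True
    have "hom_induced (int k) X {} ?pt {} (\<lambda>x. ()) ?z = homologous_rel_set k ?pt {} (chain_map k (\<lambda>x. ()) z)"
      using cyc by (intro hom_induced_chain_map) auto
    also have "\<dots> = \<one>\<^bsub>homology_group (int k) ?pt\<^esub>"
      unfolding one_relative_homology_group homologous_rel_set_eq_relboundary using pt[OF True] True by simp
    finally show ?thesis
      using cyc unfolding carrier_reduced_homology_group kernel_def carrier_relative_homology_group
      by blast
  next
    case False
    then show ?thesis
      using cyc by (simp add: un_reduced_homology_group carrier_relative_homology_group)
  qed
  then have "?z = \<one>\<^bsub>homology_group (int k) X\<^esub>"
    using triv by (simp add: trivial_group_def flip: one_reduced_homology_group)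
  then have "singular_relboundary k X {} z"
    by (simp add: homologous_rel_set_eq_relboundary)
  then show ?thesis
    by (simp add: singular_boundary)
qed

lemma frag_cmul_sign: "frag_cmul ((-1) ^ k) c = (if even k then c else - c)"
  by simp

text \<open>
  Given \<open>c k\<close>, the chain that \<open>c (Suc k)\<close> has to bound is a cycle because \<open>a\<close> is an involution,
  and it then bounds because homology vanishes in degree \<open>k\<close>. In degree 0 it is a difference of
  two points, so it also dies in the homology of a point.
\<close>

lemma hemisphere_tower_exists:
  assumes cont: "continuous_map X X a"
    and invol: "\<And>x. x \<in> topspace X \<Longrightarrow> a (a x) = x"
    and ne: "topspace X \<noteq> {}"
    and triv: "\<And>k. k < n \<Longrightarrow> trivial_group (reduced_homology_group (int k) X)"
  shows "\<exists>c. hemisphere_tower X a n c"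
  using triv
proof (induction n)
  case 0
  obtain x where x: "x \<in> topspace X" using ne by blast
  have "singular_simplex 0 X (restrict (\<lambda>_. x) (standard_simplex 0))"
    using x by (simp add: singular_simplex_def)
  then show ?case
    by (intro exI[of _ "\<lambda>_. frag_of (restrict (\<lambda>_. x) (standard_simplex 0))"])
      (auto simp: hemisphere_tower_def singular_chain_of)
next
  case (Suc n)
  then obtain c where c: "hemisphere_tower X a n c" by auto
  then have ch: "singular_chain k X (c k)" if "k \<le> n" for k
    using that by (simp add: hemisphere_tower_def)
  have aa: "chain_map k a (chain_map k a (c k)) = c k" if "k \<le> n" for k
  proof -
    have "chain_map k (a \<circ> a) (c k) = c k"
      by (rule chain_map_id_gen[OF ch[OF that]]) (simp add: invol)
    then show ?thesis by (simp add: chain_map_compose)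
  qed
  define z where "z = c n - frag_cmul ((-1) ^ n) (chain_map n a (c n))"
  have z: "singular_chain n X z"
    unfolding z_def using ch[of n] cont
    by (intro singular_chain_diff singular_chain_cmul singular_chain_chain_map) auto
  have bz: "chain_boundary n z = 0"
  proof (cases n)
    case 0
    then show ?thesis by (simp add: chain_boundary_def)
  next
    case (Suc j)
    have b: "chain_boundary (Suc j) (c (Suc j)) = c j - frag_cmul ((-1) ^ j) (chain_map j a (c j))"
      using c Suc by (simp add: hemisphere_tower_def)
    moreover have "chain_boundary n (chain_map n a (c n)) = chain_map j a (c j) - frag_cmul ((-1) ^ j) (c j)"
      using chain_boundary_chain_map[OF ch[of n], of a] aa[of j] Suc
      by (simp add: b chain_map_diff)
    ultimately show ?thesis
      unfolding z_def chain_boundary_diff chain_boundary_cmul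
      by (simp add: Suc frag_cmul_sign)
  qed
  have "chain_map n (\<lambda>x. ()) z = 0" if "n = 0"
    using fun_cong[OF chain_map_compose[of n "\<lambda>x. ()" a], of "c n"] that
    by (simp add: z_def chain_map_diff o_def)
  then obtain d where d: "singular_chain (Suc n) X d" "chain_boundary (Suc n) d = z"
    using cycle_is_boundary[OF Suc.prems z bz] by auto
  have "hemisphere_tower X a (Suc n) (c(Suc n := d))"
    using c d unfolding hemisphere_tower_def z_def by (auto simp: le_Suc_eq less_Suc_eq)
  then show ?case by blast
qed

text \<open>
  Subdivision is a natural chain map, so it commutes both with the boundary and with \<open>a\<close>, and it
  fixes points.
\<close>

lemma hemisphere_tower_subdivision:
  assumes c: "hemisphere_tower X a n c"
  shows "hemisphere_tower X a n (\<lambda>k. (singular_subdivision k ^^ M) (c k))"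
proof (induction M)
  case 0
  show ?case using c by simp
next
  case (Suc M)
  define d where "d = (\<lambda>k. (singular_subdivision k ^^ M) (c k))"
  have d: "hemisphere_tower X a n d"
    using Suc by (simp add: d_def)
  then have ch: "singular_chain k X (d k)" if "k \<le> n" for k
    using that by (simp add: hemisphere_tower_def)
  have sign: "singular_subdivision k (frag_cmul ((-1) ^ j) e) = frag_cmul ((-1) ^ j) (singular_subdivision k e)"
    for k j and e :: "'a chain"
    using singular_subdivision_diff[of k 0 e] by (simp add: frag_cmul_sign)
  have "chain_boundary (Suc k) (singular_subdivision (Suc k) (d (Suc k))) = singular_subdivision k (d k)
      - frag_cmul ((-1) ^ k) (chain_map k a (singular_subdivision k (d k)))" if "k < n" for k
  proof -
    have "chain_boundary (Suc k) (d (Suc k)) = d k - frag_cmul ((-1) ^ k) (chain_map k a (d k))"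
      using d that by (simp add: hemisphere_tower_def)
    then show ?thesis
      using chain_boundary_singular_subdivision[OF ch[of "Suc k"]] that
        naturality_singular_subdivision[OF ch[of k], of a]
      by (simp add: singular_subdivision_diff sign)
  qed
  moreover have "\<exists>s. singular_subdivision 0 (d 0) = frag_of s"
    using d singular_subdivision_zero[OF ch[of 0]] by (auto simp: hemisphere_tower_def)
  ultimately have "hemisphere_tower X a n (\<lambda>k. singular_subdivision k (d k))"
    using ch by (simp add: hemisphere_tower_def singular_chain_singular_subdivision)
  then show ?case by (simp add: d_def)
qed

lemma small_hemisphere_tower_exists:
  assumes c: "hemisphere_tower X a n c"
    and op: "\<And>U. U \<in> \<C> \<Longrightarrow> openin X U" and cover: "topspace X \<subseteq> \<Union>\<C>"
  shows "\<exists>d. hemisphere_tower X a n d \<and>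
    (\<forall>k\<le>n. \<forall>s\<in>Poly_Mapping.keys (d k). \<exists>V\<in>\<C>. s \<in> standard_simplex k \<rightarrow> V)"
proof -
  have "\<exists>M. \<forall>m\<ge>M. \<forall>s\<in>Poly_Mapping.keys ((singular_subdivision k ^^ m) (c k)).
      \<exists>V\<in>\<C>. s \<in> standard_simplex k \<rightarrow> V" if "k \<le> n" for k
  proof -
    have "singular_chain k X (c k)"
      using c that by (simp add: hemisphere_tower_def)
    from sufficient_iterated_singular_subdivision_exists[OF op cover this]
    show ?thesis by metis
  qed
  then obtain M where M: "\<And>k m s. k \<le> n \<Longrightarrow> M k \<le> m \<Longrightarrow>
      s \<in> Poly_Mapping.keys ((singular_subdivision k ^^ m) (c k)) \<Longrightarrow> \<exists>V\<in>\<C>. s \<in> standard_simplex k \<rightarrow> V"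
    by metis
  have "M k \<le> (\<Sum>k\<le>n. M k)" if "k \<le> n" for k
    using that by (intro member_le_sum) auto
  with M hemisphere_tower_subdivision[OF c] show ?thesis
    by (intro exI[of _ "\<lambda>k. (singular_subdivision k ^^ (\<Sum>k\<le>n. M k)) (c k)"]) blast
qed

section \<open>The Borsuk--Ulam theorem\<close>

text \<open>
  The parity does not depend on \<open>k\<close>. By \<open>weight_alternating_boundary\<close>, the alternating simplices
  of \<open>c (Suc k)\<close> are counted by the positively alternating ones in its boundary; of these, the
  part in \<open>c k\<close> contributes its positive ones and the antipodal part contributes the negative
  ones of \<open>c k\<close>. For \<open>k = 0\<close> there is a single point, with a nonzero label.
\<close>

lemma alternating_weight_odd:
  assumes c: "hemisphere_tower X a n c"
    and odd: "\<And>x. x \<in> topspace X \<Longrightarrow> l (a x) = - l x"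
    and nz: "\<And>x. x \<in> topspace X \<Longrightarrow> l x \<noteq> 0"
    and opp: "\<And>k s i j. k \<le> n \<Longrightarrow> s \<in> Poly_Mapping.keys (c k) \<Longrightarrow> i \<le> k \<Longrightarrow> j \<le> k \<Longrightarrow>
      l (s (vertex i)) \<noteq> - l (s (vertex j))"
    and k: "k \<le> n"
  shows "odd (weight (alternating_simplex l True k) (c k) + weight (alternating_simplex l False k) (c k))"
  using k
proof (induction k)
  case 0
  obtain s where s: "c 0 = frag_of s" and "singular_chain 0 X (c 0)"
    using c by (auto simp: hemisphere_tower_def)
  then have "s (vertex 0) \<in> topspace X"
    by (auto simp: singular_chain_of singular_simplex_def continuous_map_def Pi_iff)
  then have "l (s (vertex 0)) \<noteq> 0" by (rule nz)
  then show ?case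
    by (auto simp: s alternating_simplex_def alternates_def)
next
  case (Suc k)
  have ch: "singular_chain k X (c k)"
    using c Suc.prems by (simp add: hemisphere_tower_def)
  have "weight (alternating_simplex l True k) (chain_map k a (c k)) = weight (alternating_simplex l False k) (c k)"
    unfolding weight_chain_map
  proof (rule weight_cong)
    fix s assume "s \<in> Poly_Mapping.keys (c k)"
    with ch have "singular_simplex k X s" by (auto simp: singular_chain_def)
    from alternating_simplex_map[of k X s l a True, OF this odd nz]
    show "alternating_simplex l True k (simplex_map k a s) \<longleftrightarrow> alternating_simplex l False k s"
      by simp
  qed
  moreover have "chain_boundary (Suc k) (c (Suc k)) = c k - frag_cmul ((-1) ^ k) (chain_map k a (c k))"
    using c Suc.prems by (simp add: hemisphere_tower_def)
  ultimately have "weight (alternating_simplex l True k) (chain_boundary (Suc k) (c (Suc k)))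
    = weight (alternating_simplex l True k) (c k) - (-1) ^ k * weight (alternating_simplex l False k) (c k)"
    by (simp add: weight_diff weight_cmul)
  moreover have "odd (weight (alternating_simplex l True k) (c k) + weight (alternating_simplex l False k) (c k))"
    using Suc by simp
  moreover have "even (weight (alternating_simplex l True k) (chain_boundary (Suc k) (c (Suc k)))
    + weight (alternating_simplex l True (Suc k)) (c (Suc k))
    + weight (alternating_simplex l False (Suc k)) (c (Suc k)))"
    by (rule weight_alternating_boundary) (use opp Suc.prems in blast)
  ultimately show ?case
    by (cases "even k") (simp_all, presburger+)
qed

text \<open>
  An involution and vanishing reduced homology below degree \<open>n\<close> are what the construction of a
  hemisphere tower takes from the sphere \<open>S\<^sup>n\<close>.
\<close>

theorem borsuk_ulam_acyclic:
  fixes f :: "'a \<Rightarrow> nat \<Rightarrow> real"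
  assumes cont: "continuous_map X X a"
    and invol: "\<And>x. x \<in> topspace X \<Longrightarrow> a (a x) = x"
    and ne: "topspace X \<noteq> {}"
    and triv: "\<And>k. k < n \<Longrightarrow> trivial_group (reduced_homology_group (int k) X)"
    and contf: "\<And>i. i < n \<Longrightarrow> continuous_map X euclideanreal (\<lambda>x. f x i)"
    and oddf: "\<And>x i. x \<in> topspace X \<Longrightarrow> i < n \<Longrightarrow> f (a x) i = - f x i"
  shows "\<exists>x\<in>topspace X. \<forall>i<n. f x i = 0"
proof (rule ccontr)
  assume "\<not> ?thesis"
  then have nonvan: "\<exists>i<n. f x i \<noteq> 0" if "x \<in> topspace X" for x
    using that by blast
  define peak where "peak x = (LEAST i. i < n \<and> (\<forall>j<n. \<bar>f x j\<bar> \<le> \<bar>f x i\<bar>))" for x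
  have peak: "peak x < n" "\<forall>j<n. \<bar>f x j\<bar> \<le> \<bar>f x (peak x)\<bar>" "f x (peak x) \<noteq> 0" if "x \<in> topspace X" for x
  proof -
    have "{..<n} \<noteq> {}"
      using nonvan[OF that] by auto
    then have "\<exists>i. i < n \<and> (\<forall>j<n. \<bar>f x j\<bar> \<le> \<bar>f x i\<bar>)"
      using ex_is_arg_min_if_finite[of "{..<n}" "\<lambda>i. - \<bar>f x i\<bar>"] by (auto simp: is_arg_min_linorder)
    from LeastI_ex[OF this] show p: "peak x < n" "\<forall>j<n. \<bar>f x j\<bar> \<le> \<bar>f x (peak x)\<bar>"
      by (simp_all add: peak_def)
    show "f x (peak x) \<noteq> 0"
    proof
      assume "f x (peak x) = 0"
      with p(2) nonvan[OF that] show False by auto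
    qed
  qed
  define l where "l x = (if 0 < f x (peak x) then 1 else - 1) * (int (peak x) + 1)" for x
  have aX: "a x \<in> topspace X" if "x \<in> topspace X" for x
    using cont that by (auto simp: continuous_map_def)
  have oddl: "l (a x) = - l x" if x: "x \<in> topspace X" for x
  proof -
    have "i < n \<and> (\<forall>j<n. \<bar>f (a x) j\<bar> \<le> \<bar>f (a x) i\<bar>) \<longleftrightarrow> i < n \<and> (\<forall>j<n. \<bar>f x j\<bar> \<le> \<bar>f x i\<bar>)" for i
      using oddf[OF x] by auto
    then have "peak (a x) = peak x" by (simp only: peak_def)
    then show ?thesis
      using peak[OF x] oddf[OF x, of "peak x"] by (auto simp: l_def)
  qed
  \<comment> \<open>On such a neighbourhood of \<open>x\<close> every coordinate varies by less than two thirds of the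
    maximum of \<open>\<bar>f x i\<bar>\<close>, too little for one of them to run from a maximal positive to a
    maximal negative value.\<close>
  define W where "W x = (\<Inter>i<n. {y \<in> topspace X. f y i \<in> ball (f x i) (\<bar>f x (peak x)\<bar> / 3)})" for x
  have n0: "0 < n" using ne nonvan by fastforce
  have "openin X (W x)" for x
    unfolding W_def using n0 contf
    by (intro openin_Inter) (auto intro!: openin_continuous_map_preimage simp del: mem_ball)
  moreover have "x \<in> W x" if "x \<in> topspace X" for x
    using peak[OF that] that by (simp add: W_def)
  moreover obtain c0 where c0: "hemisphere_tower X a n c0"
    using hemisphere_tower_exists[OF cont invol ne triv] by blast
  ultimately have "\<exists>c. hemisphere_tower X a n c \<and> (\<forall>k\<le>n. \<forall>s\<in>Poly_Mapping.keys (c k).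
      \<exists>V\<in>W ` topspace X. s \<in> standard_simplex k \<rightarrow> V)"
    by (intro small_hemisphere_tower_exists[OF c0]) auto
  then obtain c where c: "hemisphere_tower X a n c"
    and small: "\<And>k s. k \<le> n \<Longrightarrow> s \<in> Poly_Mapping.keys (c k) \<Longrightarrow> \<exists>x\<in>topspace X. s \<in> standard_simplex k \<rightarrow> W x"
    by blast
  have noopp: "l y \<noteq> - l z" if y: "y \<in> W x" and z: "z \<in> W x" and x: "x \<in> topspace X" for x y z
  proof
    assume eq: "l y = - l z"
    let ?M = "\<bar>f x (peak x)\<bar>"
    have X: "y \<in> topspace X" "z \<in> topspace X"
      using y z n0 by (auto simp: W_def)
    have near: "\<bar>f x i - f y i\<bar> < ?M / 3" "\<bar>f x i - f z i\<bar> < ?M / 3" if "i < n" for i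
      using y z that by (auto simp: W_def dist_real_def)
    have "\<bar>l y\<bar> = int (peak y) + 1" "\<bar>l z\<bar> = int (peak z) + 1"
      by (auto simp: l_def)
    with eq have same: "peak z = peak y" by simp
    have "\<bar>f y (peak x)\<bar> \<le> \<bar>f y (peak y)\<bar>" "\<bar>f z (peak x)\<bar> \<le> \<bar>f z (peak z)\<bar>"
      using peak[OF X(1)] peak[OF X(2)] peak(1)[OF x] by auto
    moreover have "0 < f y (peak y) \<longleftrightarrow> \<not> 0 < f z (peak y)"
      using eq by (auto simp: l_def same split: if_splits)
    ultimately show False
      using near[OF peak(1)[OF x]] near[OF peak(1)[OF X(1)]] peak(3)[OF X(1)] peak(3)[OF X(2)]
      unfolding same by (auto simp: abs_if split: if_splits)
  qed
  have vert: "s (vertex i) \<in> topspace X" if "k \<le> n" "s \<in> Poly_Mapping.keys (c k)" "i \<le> k" for k s i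
    using c that by (force simp: hemisphere_tower_def singular_chain_def singular_simplex_def continuous_map_def Pi_iff)
  have opp: "l (s (vertex i)) \<noteq> - l (s (vertex j))"
    if ks: "k \<le> n" "s \<in> Poly_Mapping.keys (c k)" and "i \<le> k" "j \<le> k" for k s i j
  proof -
    obtain x where "x \<in> topspace X" "s \<in> standard_simplex k \<rightarrow> W x"
      using small[OF ks] by blast
    with that show ?thesis
      by (intro noopp[of _ x]) (auto simp: Pi_iff)
  qed
  have nz: "l x \<noteq> 0" for x
    by (simp add: l_def)
  have "odd (weight (alternating_simplex l True n) (c n) + weight (alternating_simplex l False n) (c n))"
    by (rule alternating_weight_odd[OF c]) (assumption | rule oddl nz opp order_refl)+
  then have "weight (alternating_simplex l True n) (c n) \<noteq> 0 \<or> weight (alternating_simplex l False n) (c n) \<noteq> 0"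
    by auto
  then obtain b where "weight (alternating_simplex l b n) (c n) \<noteq> 0"
    by (elim disjE) (rule that, assumption)+
  then obtain s where s: "s \<in> Poly_Mapping.keys (c n)" and "alternating_simplex l b n s"
    using weight_eq_0[of "c n" "alternating_simplex l b n"] by metis
  then have inj: "inj_on (\<lambda>i. l (s (vertex i))) {..n}"
    by (simp add: alternating_simplex_def)
  \<comment> \<open>The vertices of an alternating \<open>n\<close>-simplex would have \<open>n + 1\<close> different peaks among \<open>n\<close>
    indices.\<close>
  have "inj_on (\<lambda>i. peak (s (vertex i))) {..n}"
  proof (rule inj_onI)
    fix i j assume ij: "i \<in> {..n}" "j \<in> {..n}" "peak (s (vertex i)) = peak (s (vertex j))"
    then have "l (s (vertex i)) = l (s (vertex j)) \<or> l (s (vertex i)) = - l (s (vertex j))"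
      by (auto simp: l_def)
    with opp[OF le_refl s, of i j] inj ij show "i = j"
      by (auto simp: inj_on_def)
  qed
  moreover have "(\<lambda>i. peak (s (vertex i))) ` {..n} \<subseteq> {..<n}"
    using peak(1)[OF vert[OF le_refl s]] by auto
  ultimately have "card {..n} \<le> card {..<n}"
    by (rule card_inj_on_le) simp
  then show False by simp
qed

section \<open>Continuity for geometric realizations\<close>

text \<open>
  The universal property of the weak topology.
\<close>

lemma continuous_map_geometric_realization:
  "continuous_map (geometric_realization K) Y f \<longleftrightarrow>
    (\<forall>\<sigma>\<in>K. continuous_map (top_of_set (closed_simplex \<sigma>)) Y f)"
proof -
  let ?X = "\<Union>\<sigma>\<in>K. closed_simplex \<sigma>"
  have "closed_simplex \<sigma> \<inter> {x \<in> ?X. f x \<in> U} = {x \<in> closed_simplex \<sigma>. f x \<in> U}" if "\<sigma> \<in> K" for \<sigma> U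
    using that by blast
  moreover have "{x \<in> ?X. f x \<in> U} \<subseteq> ?X" for U by blast
  ultimately have "openin (geometric_realization K) {x \<in> ?X. f x \<in> U} \<longleftrightarrow>
      (\<forall>\<sigma>\<in>K. openin (top_of_set (closed_simplex \<sigma>)) {x \<in> closed_simplex \<sigma>. f x \<in> U})" for U
    unfolding openin_geometric_realization by simp
  then show ?thesis
    by (auto simp: continuous_map_def topspace_geometric_realization)
qed

text \<open>
  The function type carries the product topology, so continuity into a simplex is continuity of
  each barycentric coordinate.
\<close>

lemma continuous_map_into_closed_simplex:
  "continuous_map X (top_of_set (closed_simplex \<sigma>)) g \<longleftrightarrow>
    (\<forall>v. continuous_map X euclideanreal (\<lambda>x. g x v)) \<and> (\<forall>x\<in>topspace X. g x \<in> closed_simplex \<sigma>)"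
  unfolding continuous_map_in_subtopology euclidean_product_topology[symmetric]
    continuous_map_componentwise_UNIV by auto

section \<open>Spheres, the antipode and the coindex\<close>

lemma antipode_antipode [simp]: "antipode (antipode x) = x"
  by (simp add: antipode_def)

lemma topspace_nsphere: "topspace (nsphere m) = {x. (\<Sum>i\<le>m. (x i)\<^sup>2) = 1 \<and> (\<forall>i>m. x i = 0)}"
  by (simp add: nsphere)

lemma antipode_in_nsphere: "x \<in> topspace (nsphere m) \<Longrightarrow> antipode x \<in> topspace (nsphere m)"
  by (simp add: topspace_nsphere antipode_def)

lemma continuous_map_antipode: "continuous_map (nsphere m) (nsphere m) antipode"
proof -
  have "continuous_map (nsphere m) (powertop_real UNIV) antipode"
    unfolding continuous_map_componentwise_UNIV antipode_def
    by (intro allI continuous_map_minus continuous_map_nsphere_projection) 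
  then show ?thesis
    using antipode_in_nsphere[of _ m] by (subst (2) nsphere) (auto simp: continuous_map_in_subtopology topspace_nsphere)
qed

lemma abs_inner_nsphere_le_1:
  assumes "x \<in> topspace (nsphere m)" "y \<in> topspace (nsphere m)"
  shows "\<bar>\<Sum>i\<le>m. x i * y i\<bar> \<le> 1"
proof -
  have "(\<Sum>i\<le>m. x i * y i)\<^sup>2 \<le> 1"
    using Cauchy_Schwarz_ineq_sum[of x y "{..m}"] assms by (simp add: topspace_nsphere)
  then show ?thesis by (simp add: abs_square_le_1)
qed

lemma diam_wrt_le_iff:
  assumes "finite \<sigma>" "\<sigma> \<noteq> {}"
  shows "diam_wrt d \<sigma> \<le> r \<longleftrightarrow> (\<forall>x\<in>\<sigma>. \<forall>y\<in>\<sigma>. d x y \<le> r)"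
  unfolding diam_wrt_def using assms by (subst cSup_le_iff) auto

lemma mem_VR_complex:
  "\<sigma> \<in> VR_complex X d r \<longleftrightarrow>
    \<sigma> \<subseteq> X \<and> finite \<sigma> \<and> \<sigma> \<noteq> {} \<and> (\<forall>x\<in>\<sigma>. \<forall>y\<in>\<sigma>. d x y \<le> r)"
  unfolding VR_complex_def using diam_wrt_le_iff[of \<sigma> d r] by blast

lemma coind_ge:
  assumes "odd_map (nsphere k) antipode X a f"
  shows "enat k \<le> coind X a"
  unfolding coind_def by (rule SUP_upper) (use assms in auto)

text \<open>
  The case \<open>n = 0\<close> is excluded because the coindex is 0 also if no sphere has an odd map to the
  space.
\<close>

lemma le_coind_imp:
  assumes "enat n \<le> coind X a" "0 < n"
  shows "\<exists>k\<ge>n. \<exists>f. odd_map (nsphere k) antipode X a f"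
proof (rule ccontr)
  assume none: "\<not> ?thesis"
  have "enat k \<le> enat (n - 1)" if "\<exists>f. odd_map (nsphere k) antipode X a f" for k
  proof -
    have "k < n" using none that by (meson not_le)
    then show ?thesis by simp
  qed
  then have "coind X a \<le> enat (n - 1)"
    unfolding coind_def by (intro SUP_least) blast
  with assms(1) have "enat n \<le> enat (n - 1)" by (rule order_trans)
  with assms(2) show False by simp
qed

section \<open>Cross-polytopes in Vietoris--Rips complexes\<close>

definition signed_point :: "(nat \<Rightarrow> nat \<Rightarrow> real) \<Rightarrow> nat set \<Rightarrow> nat \<Rightarrow> nat \<Rightarrow> real"
  where "signed_point p E i = (if i \<in> E then p i else antipode (p i))"

text \<open>
  If the points \<open>p i\<close> and \<open>antipode (p i)\<close> are all distinct, this is a homeomorphism from the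
  unit sphere to the boundary of the cross-polytope that has them as vertices: squares of
  coordinates are barycentric coordinates, and signs choose the vertex.
\<close>

definition cross_polytope_map ::
    "nat \<Rightarrow> (nat \<Rightarrow> nat \<Rightarrow> real) \<Rightarrow> (nat \<Rightarrow> real) \<Rightarrow> (nat \<Rightarrow> real) \<Rightarrow> real"
  where "cross_polytope_map k p x = (\<lambda>v. \<Sum>i\<le>k.
    (max (x i) 0)\<^sup>2 * of_bool (v = p i) + (max (- x i) 0)\<^sup>2 * of_bool (v = antipode (p i)))"

lemma cross_polytope_map_in_simplex:
  assumes x: "x \<in> topspace (nsphere k)" and E: "\<And>i. i \<le> k \<Longrightarrow> if i \<in> E then 0 \<le> x i else x i \<le> 0"
  shows "cross_polytope_map k p x \<in> closed_simplex (signed_point p E ` {..k})"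
proof -
  let ?s = "signed_point p E"
  have eq: "cross_polytope_map k p x v = (\<Sum>i\<le>k. (x i)\<^sup>2 * of_bool (v = ?s i))" for v
    unfolding cross_polytope_map_def
  proof (rule sum.cong[OF refl])
    fix i assume "i \<in> {..k}"
    with E[of i] show "(max (x i) 0)\<^sup>2 * of_bool (v = p i) + (max (- x i) 0)\<^sup>2 * of_bool (v = antipode (p i))
        = (x i)\<^sup>2 * of_bool (v = ?s i)"
      by (cases "i \<in> E") (auto simp: signed_point_def max_def)
  qed
  have "(\<Sum>v\<in>?s ` {..k}. cross_polytope_map k p x v) = (\<Sum>i\<le>k. \<Sum>v\<in>?s ` {..k}. (x i)\<^sup>2 * of_bool (v = ?s i))"
    unfolding eq by (rule sum.swap)
  also have "\<dots> = (\<Sum>i\<le>k. (x i)\<^sup>2)"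
    by (rule sum.cong[OF refl]) (simp add: of_bool_def if_distrib[of "\<lambda>t. _ * t"] cong: if_cong)
  also have "\<dots> = 1" using x by (simp add: topspace_nsphere)
  finally show ?thesis
    unfolding closed_simplex_def eq by (auto intro!: sum_nonneg sum.neutral)
qed

text \<open>
  The bound on \<open>\<bar>\<langle>p i, p j\<rangle>\<bar>\<close> says that any two points chosen from different pairs \<open>\<plusminus>p i\<close> are at
  distance at most \<open>arccos (- b)\<close>, so every choice of signs spans a simplex. The realization has
  the weak topology, so continuity is checked on each closed orthant, which is mapped into a
  single simplex, and the finitely many orthants are pasted together.
\<close>

lemma odd_map_cross_polytope:
  assumes p: "\<And>i. i \<le> k \<Longrightarrow> p i \<in> topspace (nsphere m)"
    and sep: "\<And>i j. i \<le> k \<Longrightarrow> j \<le> k \<Longrightarrow> i \<noteq> j \<Longrightarrow> \<bar>\<Sum>l\<le>m. p i l * p j l\<bar> \<le> b"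
    and b: "0 \<le> b" "b \<le> 1"
  shows "odd_map (nsphere k) antipode (VR_sphere m (arccos (- b))) VR_antipode (cross_polytope_map k p)"
proof -
  let ?K = "VR_complex (topspace (nsphere m)) (geodesic_dist m) (arccos (- b))"
  define orthant where
    "orthant E = (\<Inter>i\<le>k. {x \<in> topspace (nsphere k). x i \<in> (if i \<in> E then {0..} else {..0})})" for E
  have orthantD: "if i \<in> E then 0 \<le> x i else x i \<le> 0" if "x \<in> orthant E" "i \<le> k" for x i E
  proof -
    have "x i \<in> (if i \<in> E then {0..} else {..0})"
      using that unfolding orthant_def by blast
    then show ?thesis by (simp split: if_splits)
  qed
  have simplex: "signed_point p E ` {..k} \<in> ?K" for E
  proof -
    have X: "signed_point p E i \<in> topspace (nsphere m)" if "i \<le> k" for i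
      using p[OF that] antipode_in_nsphere[OF p[OF that]] by (simp add: signed_point_def)
    have "geodesic_dist m (signed_point p E i) (signed_point p E j) \<le> arccos (- b)" if "i \<le> k" "j \<le> k" for i j
    proof -
      let ?ip = "\<Sum>l\<le>m. signed_point p E i l * signed_point p E j l"
      have "- b \<le> ?ip"
      proof (cases "i = j")
        case True
        then show ?thesis using X[OF that(1)] b by (simp add: topspace_nsphere flip: power2_eq_square)
      next
        case False
        then show ?thesis using sep[OF that]
          by (auto simp: signed_point_def antipode_def sum_negf abs_le_iff)
      qed
      then show ?thesis
        unfolding geodesic_dist_def using b abs_inner_nsphere_le_1[OF X[OF that(1)] X[OF that(2)]]
        by (intro arccos_le_arccos) auto
    qed
    then show ?thesis
      unfolding mem_VR_complex using X by auto
  qed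
  have "continuous_map (nsphere k) (geometric_realization ?K) (cross_polytope_map k p)"
  proof (rule pasting_lemma_closed[where I = "Pow {..k}" and T = orthant and f = "\<lambda>_. cross_polytope_map k p"])
    show "closedin (nsphere k) (orthant E)" for E
      unfolding orthant_def
      by (intro closedin_Inter) (auto intro!: closedin_continuous_map_preimage[OF continuous_map_nsphere_projection])
    show "continuous_map (subtopology (nsphere k) (orthant E)) (geometric_realization ?K) (cross_polytope_map k p)" for E
    proof -
      let ?S = "signed_point p E ` {..k}"
      have "continuous_map (top_of_set (closed_simplex ?S)) (geometric_realization ?K) (\<lambda>t. t)"
        using simplex[of E] continuous_map_geometric_realization[of ?K "geometric_realization ?K" "\<lambda>t. t"] by simp
      moreover have "continuous_map (subtopology (nsphere k) (orthant E)) (top_of_set (closed_simplex ?S)) (cross_polytope_map k p)"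
        unfolding continuous_map_into_closed_simplex
      proof (intro conjI allI ballI)
        fix v
        show "continuous_map (subtopology (nsphere k) (orthant E)) euclideanreal (\<lambda>x. cross_polytope_map k p x v)"
          unfolding cross_polytope_map_def
          by (intro continuous_map_from_subtopology continuous_intros continuous_map_nsphere_projection) auto
      next
        fix x assume "x \<in> topspace (subtopology (nsphere k) (orthant E))"
        then show "cross_polytope_map k p x \<in> closed_simplex ?S"
          by (intro cross_polytope_map_in_simplex orthantD) auto
      qed
      ultimately show ?thesis
        using continuous_map_compose[of _ _ "cross_polytope_map k p" _ "\<lambda>t. t"] by (simp add: o_def)
    qed
    show "\<exists>E. E \<in> Pow {..k} \<and> x \<in> orthant E \<and> cross_polytope_map k p x = cross_polytope_map k p x"
      if "x \<in> topspace (nsphere k)" for x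
      using that by (intro exI[of _ "{i. i \<le> k \<and> 0 \<le> x i}"]) (auto simp: orthant_def)
  qed auto
  moreover have "cross_polytope_map k p (antipode x) = VR_antipode (cross_polytope_map k p x)" for x
  proof -
    have "v = antipode u \<longleftrightarrow> antipode v = u" for u v by (metis antipode_antipode)
    then show ?thesis
      by (auto simp: cross_polytope_map_def VR_antipode_def antipode_def[of x] intro!: sum.cong)
  qed
  ultimately show ?thesis
    by (simp add: odd_map_def VR_sphere_def)
qed

section \<open>Odd maps from Vietoris--Rips complexes to Euclidean space\<close>

lemma borsuk_ulam:
  fixes f :: "(nat \<Rightarrow> real) \<Rightarrow> nat \<Rightarrow> real"
  assumes "\<And>i. i < n \<Longrightarrow> continuous_map (nsphere n) euclideanreal (\<lambda>x. f x i)"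
    and "\<And>x i. x \<in> topspace (nsphere n) \<Longrightarrow> i < n \<Longrightarrow> f (antipode x) i = - f x i"
  shows "\<exists>x\<in>topspace (nsphere n). \<forall>i<n. f x i = 0"
proof (rule borsuk_ulam_acyclic[where a = antipode])
  show "topspace (nsphere n) \<noteq> {}"
    using in_topspace_nsphere by blast
  show "trivial_group (reduced_homology_group (int k) (nsphere n))" if "k < n" for k
    using that by (simp add: trivial_reduced_homology_group_nsphere)
qed (use assms continuous_map_antipode in auto)

text \<open>
  The form of the Borsuk--Ulam theorem used below: composing with \<open>g\<close> and, if \<open>card I < n\<close>,
  filling up with zero coordinates gives an odd map \<open>S\<^sup>n \<rightarrow> \<real>\<^sup>n\<close> without zeros.
\<close>

lemma odd_map_dim_less:
  fixes F :: "'a \<Rightarrow> 'i \<Rightarrow> real"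
  assumes g: "odd_map (nsphere n) antipode X a g" and fin: "finite I"
    and cont: "\<And>i. i \<in> I \<Longrightarrow> continuous_map X euclideanreal (\<lambda>x. F x i)"
    and odd: "\<And>x i. x \<in> topspace X \<Longrightarrow> i \<in> I \<Longrightarrow> F (a x) i = - F x i"
    and nz: "\<And>x. x \<in> topspace X \<Longrightarrow> \<exists>i\<in>I. F x i \<noteq> 0"
  shows "n < card I"
proof (rule ccontr)
  assume "\<not> n < card I"
  then have le: "card I \<le> n" by simp
  obtain h where h: "bij_betw h {0..<card I} I"
    using ex_bij_betw_nat_finite[OF fin] by blast
  have hI: "h i \<in> I" if "i < card I" for i
    using h that by (auto simp: bij_betw_def)
  have contg: "continuous_map (nsphere n) X g" and oddg: "\<And>x. x \<in> topspace (nsphere n) \<Longrightarrow> g (antipode x) = a (g x)"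
    using g by (auto simp: odd_map_def)
  have gX: "g x \<in> topspace X" if "x \<in> topspace (nsphere n)" for x
    using contg that by (auto simp: continuous_map_def)
  define f where "f x i = (if i < card I then F (g x) (h i) else 0)" for x i
  have "continuous_map (nsphere n) euclideanreal (\<lambda>x. f x i)" for i
  proof (cases "i < card I")
    case True
    then show ?thesis
      using continuous_map_compose[OF contg cont[OF hI[OF True]]] by (simp add: f_def o_def)
  qed (simp add: f_def)
  moreover have "f (antipode x) i = - f x i" if "x \<in> topspace (nsphere n)" for x i
    using odd[OF gX[OF that] hI] oddg[OF that] by (simp add: f_def)
  ultimately obtain x where x: "x \<in> topspace (nsphere n)" "\<forall>i<n. f x i = 0"
    using borsuk_ulam[of n f] by blast
  obtain j where j: "j \<in> I" "F (g x) j \<noteq> 0"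
    using nz[OF gX[OF x(1)]] by blast
  then have "j \<in> h ` {0..<card I}"
    using h by (simp add: bij_betw_def)
  then obtain i where i: "i < card I" "j = h i"
    by auto
  then have "f x i = F (g x) j" by (simp add: f_def)
  moreover have "f x i = 0" using x(2) i(1) le by simp
  ultimately show False using j(2) by simp
qed

text \<open>
  Summing over the support of \<open>t\<close> makes the value independent of the simplex in which \<open>t\<close> is
  considered.
\<close>

definition cell_balance :: "(nat \<Rightarrow> real) set \<Rightarrow> ((nat \<Rightarrow> real) \<Rightarrow> real) \<Rightarrow> real"
  where "cell_balance C t =
    (\<Sum>v | t v \<noteq> 0. t v * (of_bool (v \<in> C) - of_bool (antipode v \<in> C)))"

lemma cell_balance_closed_simplex:
  assumes "finite \<sigma>" "t \<in> closed_simplex \<sigma>"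
  shows "cell_balance C t = (\<Sum>v\<in>\<sigma>. t v * (of_bool (v \<in> C) - of_bool (antipode v \<in> C)))"
  unfolding cell_balance_def
  by (rule sum.mono_neutral_left) (use assms in \<open>auto simp: closed_simplex_def\<close>)

lemma cell_balance_antipode: "cell_balance C (VR_antipode t) = - cell_balance C t"
proof -
  have "cell_balance C (VR_antipode t) =
      (\<Sum>v | t v \<noteq> 0. t v * (of_bool (antipode v \<in> C) - of_bool (v \<in> C)))"
    unfolding cell_balance_def VR_antipode_def
    by (rule sum.reindex_bij_witness[of _ antipode antipode]) auto
  then show ?thesis
    by (simp add: cell_balance_def sum_negf[symmetric] algebra_simps)
qed

text \<open>
  The balances of the cells form an odd map that is affine on each simplex, hence continuous
  although the cells are arbitrary sets. It has no zero: a vertex \<open>v\<close> of a simplex lies in some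
  \<open>C i\<close> or \<open>antipode v\<close> does, and by \<open>small\<close> no vertex of the same simplex can compensate, since
  it would be farther from \<open>v\<close> than \<open>r\<close>.
\<close>

lemma VR_odd_map_dim_less:
  fixes C :: "'i \<Rightarrow> (nat \<Rightarrow> real) set"
  assumes g: "odd_map (nsphere n) antipode (VR_sphere m r) VR_antipode g" and fin: "finite I"
    and cover: "\<And>v. v \<in> topspace (nsphere m) \<Longrightarrow> \<exists>i\<in>I. v \<in> C i \<or> antipode v \<in> C i"
    and small: "\<And>i v w. i \<in> I \<Longrightarrow> v \<in> topspace (nsphere m) \<Longrightarrow> w \<in> topspace (nsphere m) \<Longrightarrow>
      v \<in> C i \<Longrightarrow> w \<in> C i \<Longrightarrow> r < geodesic_dist m v (antipode w)"
  shows "n < card I"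
proof (rule odd_map_dim_less[OF g fin, where F = "\<lambda>t i. cell_balance (C i) t"])
  let ?K = "VR_complex (topspace (nsphere m)) (geodesic_dist m) r"
  show "continuous_map (VR_sphere m r) euclideanreal (cell_balance (C i))" for i
    unfolding VR_sphere_def continuous_map_geometric_realization
  proof
    fix \<sigma> assume "\<sigma> \<in> ?K"
    then have fin: "finite \<sigma>" by (simp add: mem_VR_complex)
    have "continuous_on (closed_simplex \<sigma>) (\<lambda>t. \<Sum>v\<in>\<sigma>. t v * (of_bool (v \<in> C i) - of_bool (antipode v \<in> C i)))"
      by (intro continuous_intros continuous_on_subset[OF continuous_on_product_coordinates]) auto
    then have "continuous_on (closed_simplex \<sigma>) (cell_balance (C i))"
      by (rule continuous_on_eq) (simp add: cell_balance_closed_simplex[OF fin])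
    then show "continuous_map (top_of_set (closed_simplex \<sigma>)) euclideanreal (cell_balance (C i))"
      by simp
  qed
  show "cell_balance (C i) (VR_antipode t) = - cell_balance (C i) t" for t i
    by (rule cell_balance_antipode)
  fix t assume "t \<in> topspace (VR_sphere m r)"
  then obtain \<sigma> where \<sigma>: "\<sigma> \<in> ?K" "t \<in> closed_simplex \<sigma>"
    by (auto simp: VR_sphere_def topspace_geometric_realization)
  then have fin: "finite \<sigma>" and sub: "\<And>v. v \<in> \<sigma> \<Longrightarrow> v \<in> topspace (nsphere m)"
    and close: "\<And>v w. v \<in> \<sigma> \<Longrightarrow> w \<in> \<sigma> \<Longrightarrow> geodesic_dist m v w \<le> r"
    by (auto simp: mem_VR_complex)
  have nonneg: "0 \<le> t v" for v
    using \<sigma> by (simp add: closed_simplex_def)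
  have "(\<Sum>v\<in>\<sigma>. t v) = 1"
    using \<sigma> by (simp add: closed_simplex_def)
  then have "\<exists>v\<in>\<sigma>. t v \<noteq> 0"
    by (metis sum.neutral zero_neq_one)
  then obtain v where v: "v \<in> \<sigma>" "0 < t v"
    using nonneg by (metis less_eq_real_def)
  obtain i where i: "i \<in> I" "v \<in> C i \<or> antipode v \<in> C i"
    using cover sub v by blast
  from i(2) have "cell_balance (C i) t \<noteq> 0"
  proof
    assume vC: "v \<in> C i"
    have "antipode w \<notin> C i" if "w \<in> \<sigma>" for w
      using small[OF i(1) _ _ vC, of "antipode w"] sub v that antipode_in_nsphere close[OF v(1) that] by force
    then have "cell_balance (C i) t = (\<Sum>w\<in>\<sigma>. t w * of_bool (w \<in> C i))"
      unfolding cell_balance_closed_simplex[OF fin \<sigma>(2)] by (intro sum.cong) auto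
    also have "0 < \<dots>"
      by (rule sum_pos2[OF fin v(1)]) (use v vC nonneg in auto)
    finally show ?thesis by simp
  next
    assume vC: "antipode v \<in> C i"
    have "w \<notin> C i" if "w \<in> \<sigma>" for w
      using small[OF i(1) _ _ _ vC, of w] sub v that antipode_in_nsphere close[OF that v(1)] by force
    then have "cell_balance (C i) t = - (\<Sum>w\<in>\<sigma>. t w * of_bool (antipode w \<in> C i))"
      unfolding cell_balance_closed_simplex[OF fin \<sigma>(2)] sum_negf[symmetric] by (intro sum.cong) auto
    moreover have "0 < (\<Sum>w\<in>\<sigma>. t w * of_bool (antipode w \<in> C i))"
      by (rule sum_pos2[OF fin v(1)]) (use v vC nonneg in auto)
    ultimately show ?thesis by simp
  qed
  with i(1) show "\<exists>i\<in>I. cell_balance (C i) t \<noteq> 0" by blast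
qed

section \<open>Quadratic bounds for the cosine\<close>

lemma cos_ge_quadratic: "1 - x\<^sup>2 / 2 \<le> cos x" for x :: real
proof -
  have "(sin (x / 2))\<^sup>2 \<le> (x / 2)\<^sup>2"
    by (rule abs_le_square_iff[THEN iffD1, OF abs_sin_x_le_abs_x])
  then show ?thesis
    using cos_double_sin[of "x / 2"] by (simp add: power_divide)
qed

text \<open>
  By the mean value theorem and \<open>cos z \<ge> 1 / 2\<close> on \<open>[0, 1]\<close>, \<open>sin y \<ge> y / 2\<close> there; then use the
  half-angle formula.
\<close>

lemma cos_le_quadratic:
  fixes x :: real
  assumes "0 \<le> x" "x \<le> 2"
  shows "cos x \<le> 1 - x\<^sup>2 / 8"
proof (cases "x = 0")
  case False
  define y where "y = x / 2"
  have y: "0 < y" "y \<le> 1" "x = 2 * y"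
    using assms False by (auto simp: y_def)
  obtain z where z: "0 < z" "z < y" "sin y - sin 0 = (y - 0) * cos z"
    using MVT2[of 0 y sin cos] y by (auto intro: DERIV_sin)
  have "z\<^sup>2 \<le> 1" using z y by (simp add: power_le_one)
  then have "1 / 2 \<le> cos z" using cos_ge_quadratic[of z] by simp
  then have "y * (1 / 2) \<le> sin y" using z y by simp
  then have "(y * (1 / 2))\<^sup>2 \<le> (sin y)\<^sup>2"
    using y by (intro power_mono) auto
  then show ?thesis
    using cos_double_sin[of y] y by (simp add: power_mult_distrib power_divide)
qed simp

section \<open>Packing the sphere\<close>

text \<open>
  Place a grid with \<open>q ^ m\<close> points and mesh \<open>1 / (m q)\<close> in the cube \<open>[0, 1/m]\<^sup>m\<close>, which lies in
  the unit ball, and lift it vertically to the sphere. All coordinates are nonnegative, so inner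
  products are nonnegative as well and it is enough to bound them from above by means of the
  distance.
\<close>

lemma separated_points_exist:
  assumes m: "1 \<le> m" and q: "1 \<le> q" and n: "n < q ^ m"
  shows "\<exists>p. (\<forall>i\<le>n. p i \<in> topspace (nsphere m)) \<and>
    (\<forall>i\<le>n. \<forall>j\<le>n. i \<noteq> j \<longrightarrow> \<bar>\<Sum>l\<le>m. p i l * p j l\<bar> \<le> 1 - (1 / (real m * real q))\<^sup>2 / 2)"
proof -
  let ?G = "{..<m} \<rightarrow>\<^sub>E {..<q}"
  have "card {..n} \<le> card ?G"
    using n by (simp add: card_PiE)
  then obtain e where e: "e ` {..n} \<subseteq> ?G" "inj_on e {..n}"
    using card_le_inj[of "{..n}" ?G] by (auto simp: finite_PiE)
  define y where "y i l = real (e i l) / (real m * real q)" for i l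
  define p where "p i l = (if l < m then y i l else if l = m then sqrt (1 - (\<Sum>l<m. (y i l)\<^sup>2)) else 0)" for i l
  have eq: "(\<Sum>l\<le>m. h l) = (\<Sum>l<m. h l) + h m" for h :: "nat \<Rightarrow> real"
    by (simp flip: lessThan_Suc_atMost)
  have y0: "0 \<le> y i l" for i l
    by (simp add: y_def)
  have y1: "(\<Sum>l<m. (y i l)\<^sup>2) \<le> 1" if "i \<le> n" for i
  proof -
    have "y i l \<le> 1 / real m" if "l < m" for l
    proof -
      have "e i \<in> ?G" using e(1) \<open>i \<le> n\<close> by auto
      then have "e i l < q" using that by (auto dest: PiE_mem)
      then show ?thesis using m q by (simp add: y_def field_simps)
    qed
    then have "(\<Sum>l<m. (y i l)\<^sup>2) \<le> (\<Sum>l<m. (1 / real m)\<^sup>2)"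
      using y0 by (intro sum_mono power_mono) auto
    also have "\<dots> \<le> 1"
      using m by (simp add: power2_eq_square)
    finally show ?thesis .
  qed
  have p0: "0 \<le> p i l" if "i \<le> n" for i l
    using y0 y1[OF that] by (simp add: p_def)
  have sphere: "(\<Sum>l\<le>m. (p i l)\<^sup>2) = 1" if "i \<le> n" for i
    using y1[OF that] by (simp add: eq p_def)
  have "\<bar>\<Sum>l\<le>m. p i l * p j l\<bar> \<le> 1 - (1 / (real m * real q))\<^sup>2 / 2"
    if ij: "i \<le> n" "j \<le> n" "i \<noteq> j" for i j
  proof -
    have "e i \<in> ?G" "e j \<in> ?G" "e i \<noteq> e j"
      using e ij by (auto simp: inj_on_def)
    then obtain l where l: "l < m" "e i l \<noteq> e j l"
      by (metis PiE_ext lessThan_iff)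
    have "1 \<le> \<bar>real (e i l) - real (e j l)\<bar>"
      using l(2) by linarith
    then have "1 / (real m * real q) \<le> \<bar>real (e i l) - real (e j l)\<bar> / (real m * real q)"
      by (intro divide_right_mono) auto
    also have "\<dots> = \<bar>p i l - p j l\<bar>"
      using l(1) by (simp add: p_def y_def flip: diff_divide_distrib)
    finally have "(1 / (real m * real q))\<^sup>2 \<le> \<bar>p i l - p j l\<bar>\<^sup>2"
      by (intro power_mono) auto
    also have "\<dots> \<le> (\<Sum>l\<le>m. (p i l - p j l)\<^sup>2)"
      unfolding power2_abs using l(1) by (intro member_le_sum) auto
    also have "\<dots> = (\<Sum>l\<le>m. (p i l)\<^sup>2) + (\<Sum>l\<le>m. (p j l)\<^sup>2) - 2 * (\<Sum>l\<le>m. p i l * p j l)"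
      by (simp add: power2_diff sum.distrib sum_subtractf sum_distrib_left mult.assoc del: sum.atMost_Suc)
    also have "\<dots> = 2 - 2 * (\<Sum>l\<le>m. p i l * p j l)"
      using sphere ij by simp
    finally have "(\<Sum>l\<le>m. p i l * p j l) \<le> 1 - (1 / (real m * real q))\<^sup>2 / 2"
      by simp
    moreover have "0 \<le> (\<Sum>l\<le>m. p i l * p j l)"
      using p0 ij by (intro sum_nonneg mult_nonneg_nonneg) auto
    ultimately show ?thesis by simp
  qed
  moreover have "p i \<in> topspace (nsphere m)" if "i \<le> n" for i
    using sphere[OF that] by (auto simp: topspace_nsphere p_def)
  ultimately show ?thesis by blast
qed

text \<open>
  With \<open>s\<close> the mesh of the grid, inner products at most \<open>1 - s\<^sup>2 / 2 \<le> cos s\<close> give the scale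
  \<open>\<pi> - arccos (1 - s\<^sup>2 / 2) \<le> \<pi> - s\<close>.
\<close>

lemma coind_VR_ge:
  assumes m: "1 \<le> m" and q: "1 \<le> q" and n: "n < q ^ m"
  shows "\<exists>r\<ge>0. r \<le> pi - 1 / (real m * real q) \<and> enat n \<le> coind (VR_sphere m r) VR_antipode"
proof -
  define s where "s = 1 / (real m * real q)"
  define b where "b = 1 - s\<^sup>2 / 2"
  have "1 * 1 \<le> real m * real q" using m q by (intro mult_mono) auto
  then have s: "0 \<le> s" "s \<le> 1" by (auto simp: s_def divide_le_eq_1)
  then have "s\<^sup>2 \<le> 1" by (simp add: power_le_one)
  then have b: "0 \<le> b" "b \<le> 1" by (auto simp: b_def)
  obtain p where "\<And>i. i \<le> n \<Longrightarrow> p i \<in> topspace (nsphere m)"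
    "\<And>i j. i \<le> n \<Longrightarrow> j \<le> n \<Longrightarrow> i \<noteq> j \<Longrightarrow> \<bar>\<Sum>l\<le>m. p i l * p j l\<bar> \<le> b"
    using separated_points_exist[OF m q n] unfolding b_def s_def by blast
  from coind_ge[OF odd_map_cross_polytope[of n p m b, OF this b]]
  have "enat n \<le> coind (VR_sphere m (arccos (- b))) VR_antipode" .
  moreover have "arccos (- b) \<le> pi - s"
  proof -
    have "arccos (cos s) \<le> arccos b"
      using b cos_ge_quadratic[of s] by (intro arccos_le_arccos) (auto simp: b_def)
    moreover have "arccos (cos s) = s"
      using s pi_ge_two by (intro arccos_cos) auto
    ultimately show ?thesis
      using b by (simp add: arccos_minus)
  qed
  moreover have "0 \<le> arccos (- b)"
    using b by (intro arccos_lbound) auto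
  ultimately show ?thesis
    unfolding s_def by blast
qed

lemma c_VR_le:
  assumes "1 \<le> m" "1 \<le> q" "n < q ^ m"
  shows "c_VR m n \<le> pi - 1 / (real m * real q)"
proof -
  obtain r where "0 \<le> r" "r \<le> pi - 1 / (real m * real q)" "enat n \<le> coind (VR_sphere m r) VR_antipode"
    using coind_VR_ge[OF assms] by blast
  moreover from this have "c_VR m n \<le> r"
    unfolding c_VR_def by (intro cInf_lower bdd_belowI[of _ 0]) auto
  ultimately show ?thesis by linarith
qed

section \<open>Covering the sphere\<close>

text \<open>
  Project the sphere radially to the boundary of the cube \<open>[-1, 1]\<^bsup>m+1\<^esup>\<close> and cut each face into
  small cubes of side \<open>1 / K\<close>. The index \<open>(k, g)\<close> names the face on which coordinate \<open>k\<close> equals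
  1 and the small cube in it. The opposite faces are reached through antipodes.
\<close>

definition cube_cell :: "nat \<Rightarrow> nat \<Rightarrow> nat \<times> (nat \<Rightarrow> int) \<Rightarrow> (nat \<Rightarrow> real) set"
  where "cube_cell m K = (\<lambda>(k, g). {v. 0 < v k \<and> (\<forall>j\<le>m. \<bar>v j\<bar> \<le> v k) \<and>
    (\<forall>j\<in>{..m} - {k}. \<lfloor>real K * (v j / v k)\<rfloor> = g j)})"

definition cube_cell_indices :: "nat \<Rightarrow> nat \<Rightarrow> (nat \<times> (nat \<Rightarrow> int)) set"
  where "cube_cell_indices m K = (SIGMA k:{..m}. ({..m} - {k}) \<rightarrow>\<^sub>E {- int K..int K})"

lemma finite_cube_cell_indices: "finite (cube_cell_indices m K)"
  unfolding cube_cell_indices_def by (intro finite_SigmaI finite_PiE) auto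

text \<open>
  The exponent is \<open>m\<close> and not \<open>m + 1\<close> because coordinate \<open>k\<close> is constant on its face; this is
  what makes the covering number have the right order.
\<close>

lemma card_cube_cell_indices: "card (cube_cell_indices m K) = (m + 1) * (2 * K + 1) ^ m"
proof -
  have "card (({..m} - {k}) \<rightarrow>\<^sub>E {- int K..int K}) = (2 * K + 1) ^ m" if "k \<le> m" for k
  proof -
    have "nat (2 * int K + 1) = Suc (2 * K)" by linarith
    then show ?thesis using that by (simp add: card_PiE)
  qed
  then have "card (cube_cell_indices m K) = (\<Sum>k\<le>m. (2 * K + 1) ^ m)"
    unfolding cube_cell_indices_def by (subst card_SigmaI) (auto simp: finite_PiE)
  then show ?thesis by simp
qed

lemma cube_cells_cover:
  assumes v: "v \<in> topspace (nsphere m)"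
  shows "\<exists>i\<in>cube_cell_indices m K. v \<in> cube_cell m K i \<or> antipode v \<in> cube_cell m K i"
proof -
  have floor: "\<lfloor>t\<rfloor> \<in> {- int K..int K}" if "\<bar>t\<bar> \<le> real K" for t :: real
    using that unfolding atLeastAtMost_iff le_floor_iff floor_le_iff by auto
  have pos: "\<exists>i\<in>cube_cell_indices m K. u \<in> cube_cell m K i"
    if k: "k \<le> m" "0 < u k" and max: "\<forall>j\<le>m. \<bar>u j\<bar> \<le> u k" for u k
  proof -
    define g where "g = (\<lambda>j\<in>{..m} - {k}. \<lfloor>real K * (u j / u k)\<rfloor>)"
    have "\<lfloor>real K * (u j / u k)\<rfloor> \<in> {- int K..int K}" if "j \<le> m" for j
    proof -
      have "\<bar>u j / u k\<bar> \<le> 1" using max that k by (simp add: abs_divide)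
      then have "\<bar>real K * (u j / u k)\<bar> \<le> real K * 1"
        unfolding abs_mult by (intro mult_mono) auto
      then have "\<bar>real K * (u j / u k)\<bar> \<le> real K"
        unfolding mult_1_right .
      then show ?thesis by (rule floor)
    qed
    then have "(k, g) \<in> cube_cell_indices m K"
      using k by (auto simp: cube_cell_indices_def g_def)
    moreover have "u \<in> cube_cell m K (k, g)"
      using k max by (simp add: cube_cell_def g_def)
    ultimately show ?thesis by blast
  qed
  obtain k where k: "k \<le> m" "\<And>j. j \<le> m \<Longrightarrow> \<bar>v j\<bar> \<le> \<bar>v k\<bar>"
    using ex_is_arg_min_if_finite[of "{..m}" "\<lambda>j. - \<bar>v j\<bar>"] by (auto simp: is_arg_min_linorder)
  have "v k \<noteq> 0"
  proof
    assume "v k = 0"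
    then have "v j = 0" if "j \<le> m" for j using k(2)[OF that] by simp
    then have "(\<Sum>j\<le>m. (v j)\<^sup>2) = 0" by simp
    with v show False by (simp add: topspace_nsphere)
  qed
  then consider "0 < v k" | "0 < antipode v k" by (auto simp: antipode_def neq_iff)
  then show ?thesis
  proof cases
    case 1
    then show ?thesis using pos[of k v] k by auto
  next
    case 2
    then show ?thesis using pos[of k "antipode v"] k by (auto simp: antipode_def)
  qed
qed

text \<open>
  The projections \<open>v / a\<close> and \<open>w / b\<close> to the cube have squared distance at most \<open>m / K\<^sup>2\<close>, and
  radial projection back to the sphere does not increase distances because \<open>a\<close> and \<open>b\<close> are at
  most 1.
\<close>

lemma cube_cell_inner_ge:
  assumes K: "1 \<le> K" and k: "k \<le> m"
    and v: "v \<in> topspace (nsphere m)" "v \<in> cube_cell m K (k, g)"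
    and w: "w \<in> topspace (nsphere m)" "w \<in> cube_cell m K (k, g)"
  shows "1 - real m / (real K)\<^sup>2 / 2 \<le> (\<Sum>j\<le>m. v j * w j)"
proof -
  define a where "a = v k"
  define b where "b = w k"
  let ?S = "\<Sum>j\<le>m. v j * w j"
  have pos: "0 < a" "0 < b"
    using v w by (auto simp: a_def b_def cube_cell_def)
  have v1: "(\<Sum>j\<le>m. (v j)\<^sup>2) = 1" and w1: "(\<Sum>j\<le>m. (w j)\<^sup>2) = 1"
    using v w by (auto simp: topspace_nsphere)
  have "a\<^sup>2 \<le> (\<Sum>j\<le>m. (v j)\<^sup>2)" "b\<^sup>2 \<le> (\<Sum>j\<le>m. (w j)\<^sup>2)"
    unfolding a_def b_def using k by (auto intro!: member_le_sum)
  then have ab: "a * b \<le> 1"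
    using pos v1 w1 by (intro mult_le_one) (auto simp: power2_le_iff_abs_le abs_square_le_1)
  have term_le: "(v j / a - w j / b)\<^sup>2 \<le> (if j = k then 0 else (1 / real K)\<^sup>2)" if "j \<le> m" for j
  proof (cases "j = k")
    case True
    then show ?thesis using pos by (simp add: a_def b_def)
  next
    case False
    then have "\<lfloor>real K * (v j / a)\<rfloor> = \<lfloor>real K * (w j / b)\<rfloor>"
      using v w that by (simp add: cube_cell_def a_def b_def)
    then have "\<bar>real K * (v j / a) - real K * (w j / b)\<bar> \<le> 1"
      by linarith
    then have "real K * \<bar>v j / a - w j / b\<bar> \<le> 1"
      unfolding right_diff_distrib[symmetric] abs_mult by simp
    then have "\<bar>v j / a - w j / b\<bar> \<le> 1 / real K"
      using K by (simp add: field_simps)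
    then have "\<bar>v j / a - w j / b\<bar>\<^sup>2 \<le> (1 / real K)\<^sup>2"
      by (intro power_mono) auto
    then show ?thesis using False by simp
  qed
  have "1 / a\<^sup>2 + 1 / b\<^sup>2 - 2 * ?S / (a * b) = (\<Sum>j\<le>m. (v j / a - w j / b)\<^sup>2)"
  proof -
    have "(\<Sum>j\<le>m. (v j / a - w j / b)\<^sup>2)
        = (\<Sum>j\<le>m. (v j)\<^sup>2 / a\<^sup>2 + (w j)\<^sup>2 / b\<^sup>2 - (v j * w j) * (2 / (a * b)))"
      by (rule sum.cong[OF refl]) (simp add: power2_diff power_divide)
    also have "\<dots> = (\<Sum>j\<le>m. (v j)\<^sup>2) / a\<^sup>2 + (\<Sum>j\<le>m. (w j)\<^sup>2) / b\<^sup>2 - ?S * (2 / (a * b))"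
      by (simp only: sum.distrib sum_subtractf sum_divide_distrib sum_distrib_right)
    finally show ?thesis using v1 w1 by simp
  qed
  also have "\<dots> \<le> (\<Sum>j\<le>m. if j = k then 0 else (1 / real K)\<^sup>2)"
    using term_le by (intro sum_mono) auto
  also have "\<dots> = (\<Sum>j\<in>{..m} - {k}. (1 / real K)\<^sup>2)"
    by (intro sum.mono_neutral_cong_right) auto
  also have "\<dots> = real m / (real K)\<^sup>2"
    using k by (simp add: power_divide)
  finally have "1 / a\<^sup>2 + 1 / b\<^sup>2 - 2 * ?S / (a * b) \<le> real m / (real K)\<^sup>2" .
  moreover have "2 / (a * b) \<le> 1 / a\<^sup>2 + 1 / b\<^sup>2"
    using zero_le_power2[of "1 / a - 1 / b"] by (simp add: power2_diff power_divide)
  ultimately have "(2 - 2 * ?S) / (a * b) \<le> real m / (real K)\<^sup>2"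
    by (simp add: diff_divide_distrib)
  then have "2 - 2 * ?S \<le> real m / (real K)\<^sup>2 * (a * b)"
    using pos by (simp add: divide_le_eq)
  also have "\<dots> \<le> real m / (real K)\<^sup>2 * 1"
    using ab by (intro mult_left_mono) auto
  finally show ?thesis by simp
qed

text \<open>
  A set of diameter at most \<open>\<delta>\<close> and its antipode are at distance at least \<open>\<pi> - \<delta>\<close>. Here
  \<open>\<delta> = 3m / K\<close> is chosen with \<open>\<delta>\<^sup>2 / 8 \<ge> m / (2 K\<^sup>2)\<close>, so that \<open>cos_le_quadratic\<close> matches
  \<open>cube_cell_inner_ge\<close>.
\<close>

lemma cube_cell_small:
  assumes K: "3 * m \<le> 2 * K" and m: "1 \<le> m" and k: "k \<le> m"
    and v: "v \<in> topspace (nsphere m)" "v \<in> cube_cell m K (k, g)"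
    and w: "w \<in> topspace (nsphere m)" "w \<in> cube_cell m K (k, g)"
  shows "pi - 3 * real m / real K \<le> geodesic_dist m v (antipode w)"
proof -
  define \<delta> where "\<delta> = 3 * real m / real K"
  let ?S = "\<Sum>j\<le>m. v j * w j"
  have K1: "1 \<le> K" using K m by linarith
  have \<delta>: "0 \<le> \<delta>" "\<delta> \<le> 2"
    using K K1 by (auto simp: \<delta>_def divide_le_eq)
  have "real m * 4 \<le> real m * (9 * real m)"
    using m by (intro mult_left_mono) auto
  then have "real m / (real K)\<^sup>2 / 2 \<le> \<delta>\<^sup>2 / 8"
    using K1 by (simp add: \<delta>_def power_divide power_mult_distrib divide_right_mono power2_eq_square field_simps)
  then have "cos \<delta> \<le> ?S"
    using cos_le_quadratic[OF \<delta>] cube_cell_inner_ge[OF K1 k v w] by linarith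
  then have "arccos (- cos \<delta>) \<le> arccos (- ?S)"
    using abs_inner_nsphere_le_1[OF v(1) w(1)] by (intro arccos_le_arccos) auto
  moreover have "arccos (- cos \<delta>) = pi - \<delta>"
    using \<delta> pi_ge_two by (simp add: arccos_minus arccos_cos)
  ultimately show ?thesis
    by (simp add: geodesic_dist_def antipode_def sum_negf \<delta>_def)
qed

lemma c_VR_ge:
  assumes m: "1 \<le> m" and K: "3 * m \<le> 2 * K" and n: "(m + 1) * (2 * K + 1) ^ m \<le> n"
  shows "pi - 3 * real m / real K \<le> c_VR m n"
  unfolding c_VR_def
proof (rule cInf_greatest)
  \<comment> \<open>An infimum of the empty set would be arbitrary, so some scale with large coindex is
    needed.\<close>
  have "n < (n + 1) ^ m"
    using self_le_power[of "n + 1" m] m by simp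
  then show "{r. 0 \<le> r \<and> enat n \<le> coind (VR_sphere m r) VR_antipode} \<noteq> {}"
    using coind_VR_ge[OF m, of "n + 1" n] by auto
next
  fix r assume "r \<in> {r. 0 \<le> r \<and> enat n \<le> coind (VR_sphere m r) VR_antipode}"
  then have r: "enat n \<le> coind (VR_sphere m r) VR_antipode" by simp
  have "0 < (m + 1) * (2 * K + 1) ^ m" by simp
  then obtain k f where k: "n \<le> k" and f: "odd_map (nsphere k) antipode (VR_sphere m r) VR_antipode f"
    using le_coind_imp[OF r] n by (meson less_le_trans)
  show "pi - 3 * real m / real K \<le> r"
  proof (rule ccontr)
    assume less: "\<not> ?thesis"
    have "k < card (cube_cell_indices m K)"
    proof (rule VR_odd_map_dim_less[OF f finite_cube_cell_indices])
      show "\<exists>i\<in>cube_cell_indices m K. v \<in> cube_cell m K i \<or> antipode v \<in> cube_cell m K i"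
        if "v \<in> topspace (nsphere m)" for v
        by (rule cube_cells_cover[OF that])
      fix i v w
      assume i: "i \<in> cube_cell_indices m K" and X: "v \<in> topspace (nsphere m)" "w \<in> topspace (nsphere m)"
        and vw: "v \<in> cube_cell m K i" "w \<in> cube_cell m K i"
      obtain l g where lg: "i = (l, g)" "l \<le> m"
        using i by (auto simp: cube_cell_indices_def)
      show "r < geodesic_dist m v (antipode w)"
        using cube_cell_small[OF K m lg(2) X(1) _ X(2)] vw less unfolding lg(1) by fastforce
    qed
    then show False
      using k n by (simp add: card_cube_cell_indices)
  qed
qed

section \<open>The rate of convergence\<close>

theorem proposition7p3:
  fixes m :: nat
  assumes "1 \<le> m"
  shows "\<exists>C1 C2 :: real. 0 < C1 \<and> C1 \<le> C2 \<and>
    (\<forall>\<^sub>F n :: nat in sequentially.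
      C1 * real n powr (- 1 / real m) \<le> pi - c_VR m n \<and>
      pi - c_VR m n \<le> C2 * real n powr (- 1 / real m))"
proof -
  define C1 where "C1 = 1 / (3 * real m)"
  define C2 where "C2 = 18 * real m * (real m + 1)"
  have m: "1 \<le> real m" using assms by simp
  have "1 * 1 \<le> 18 * real m * (real m + 1)"
    using m by (intro mult_mono) auto
  moreover have "C1 \<le> 1" using m by (simp add: C1_def)
  ultimately have "C1 \<le> C2" by (simp add: C2_def)
  \<comment> \<open>For \<open>x = n powr (1 / m)\<close> at least \<open>B\<close>, the mesh parameter \<open>K\<close> below is at least \<open>2 m\<close>,
    which is enough for \<open>c_VR_ge\<close> and keeps the effect of rounding within a factor of 2.\<close>
  define B where "B = 3 * (real m + 1) * (2 * real m)"
  have "C1 * real n powr (- 1 / real m) \<le> pi - c_VR m n \<and>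
      pi - c_VR m n \<le> C2 * real n powr (- 1 / real m)" if n: "nat \<lceil>B ^ m\<rceil> \<le> n" for n
  proof -
    define x where "x = real n powr (1 / real m)"
    have B1: "1 \<le> B"
    proof -
      have "1 * 1 \<le> (3 * (real m + 1)) * (2 * real m)"
        using m by (intro mult_mono) auto
      then show ?thesis by (simp add: B_def)
    qed
    have Bn: "B ^ m \<le> real n" using n by linarith
    have "1 \<le> B ^ m" using B1 by (rule one_le_power)
    with Bn have n0: "0 < real n" by linarith
    have xm: "x ^ m = real n"
      using n0 m by (simp add: x_def powr_realpow[symmetric] powr_powr)
    have "B ^ m \<le> x ^ m" using Bn xm by simp
    then have Bx: "B \<le> x"
      using power_mono_iff[of B x m] B1 assms by (simp add: x_def)
    then have x1: "1 \<le> x" using B1 by linarith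
    have inv: "real n powr (- 1 / real m) = 1 / x"
      by (simp add: x_def powr_minus_divide)
    have low: "C1 / x \<le> pi - c_VR m n"
    proof -
      \<comment> \<open>A grid with more than \<open>n = x ^ m\<close> points needs \<open>q > x\<close>.\<close>
      define q where "q = nat \<lceil>x\<rceil> + 1"
      have q: "x < real q" "real q \<le> 3 * x" "1 \<le> q"
        using x1 by (auto simp: q_def) linarith+
      have "x ^ m < real q ^ m"
        using q x1 assms by (intro power_strict_mono) auto
      then have "n < q ^ m" using xm by (metis of_nat_less_iff of_nat_power)
      then have "1 / (real m * real q) \<le> pi - c_VR m n"
        using c_VR_le[OF assms q(3)] by fastforce
      moreover have "1 / (real m * (3 * x)) \<le> 1 / (real m * real q)"
        using q m x1 by (intro divide_left_mono mult_left_mono mult_pos_pos) auto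
      ultimately show ?thesis by (simp add: C1_def ac_simps)
    qed
    have upp: "pi - c_VR m n \<le> C2 / x"
    proof -
      \<comment> \<open>As long as \<open>K \<le> z\<close>, the number of cells is at most
        \<open>((m + 1) (3 z)) ^ m = x ^ m = n\<close>.\<close>
      define z where "z = x / (3 * (real m + 1))"
      define K where "K = nat \<lfloor>z\<rfloor>"
      have z: "2 * real m \<le> z"
        using Bx m by (simp add: z_def B_def field_simps)
      then have K: "real K \<le> z" "z / 2 \<le> real K" "2 * m \<le> K"
        using m by (auto simp: K_def) linarith+
      have "real ((m + 1) * (2 * K + 1) ^ m) = (real m + 1) * (2 * real K + 1) ^ m"
        by (simp add: algebra_simps)
      also have "\<dots> \<le> (real m + 1) * (3 * z) ^ m"
      proof -
        have "2 * real K + 1 \<le> 3 * z" using K z m by linarith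
        then show ?thesis by (intro mult_left_mono power_mono) auto
      qed
      also have "\<dots> \<le> (real m + 1) ^ m * (3 * z) ^ m"
        using z m assms by (intro mult_right_mono self_le_power) auto
      also have "\<dots> = x ^ m"
      proof -
        have "(real m + 1) * (3 * z) = x" using m by (simp add: z_def field_simps)
        then show ?thesis by (simp only: power_mult_distrib[symmetric])
      qed
      finally have "(m + 1) * (2 * K + 1) ^ m \<le> n"
        unfolding xm of_nat_le_iff .
      then have "pi - 3 * real m / real K \<le> c_VR m n"
        using K(3) by (intro c_VR_ge[OF assms]) auto
      moreover have "3 * real m / real K \<le> 3 * real m / (z / 2)"
        using K z m by (intro divide_left_mono mult_pos_pos) auto
      moreover have "3 * real m / (z / 2) = C2 / x"
        using x1 m by (simp add: z_def C2_def field_simps)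
      ultimately show ?thesis by linarith
    qed
    show ?thesis
      using low upp unfolding inv by simp
  qed
  then have "\<forall>\<^sub>F n :: nat in sequentially.
      C1 * real n powr (- 1 / real m) \<le> pi - c_VR m n \<and>
      pi - c_VR m n \<le> C2 * real n powr (- 1 / real m)"
    unfolding eventually_sequentially by blast
  moreover have "0 < C1" using m by (simp add: C1_def)
  ultimately show ?thesis
    using \<open>C1 \<le> C2\<close> by blast
qed

end
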